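(* In the external memory model with block size $B$, there is a structure occupying $O(n/B)$ blocks on a set $P$ of $n$ points in rank space (i.e., in $[U]^2$ with $U=O(n)$) such that every top-open range skyline query on $P$ can be answered in $O(1+k/B)$ I/Os in the worst case, where $k$ is the number of reported points. This query cost is asymptotically optimal.
   Context: External memory model: a machine has $M$ words of memory and a disk of unbounded size divided into blocks of $B$ consecutive words. An I/O reads one block from disk into memory or writes $B$ words from memory to a block. The space of a structure is the number of blocks it occupies; the cost of an algorithm is the number of I/Os it performs; CPU time is free. When the universe is $[U]^2$, a machine word has at least $\log_2 U$ bits, and structures may use arbitrary bit manipulation (no indivisibility assumption). For an integer $U>0$, $[U]=\{0,1,\dots,U-1\}$. The universe $[U]^2$ is called rank space when $U=O(n)$. For distinct points $p=(x_p,y_p)$, $q=(x_q,y_q)$, $p$ dominates $q$ if $x_p\ge x_q$ and $y_p\ge y_q$. The skyline of a finite point set consists of its points not dominated by any other point of the set. A range skyline query with axis-parallel rectangle $Q$ on $P$ reports the skyline of $P\cap Q$. The query is top-open if $Q=[\alpha_1,\alpha_2]\times[\beta,U]$ with $\alpha_1,\alpha_2,\beta\in[U]$ (the top edge imposes no constraint). Standing assumption: $P$ is in general position, i.e., no two points of $P$ have the same $x$-coordinate or the same $y$-coordinate. *)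

theory Defs
  imports Complex_Main
begin

section \<open>Range skylines\<close>

type_synonym point = "nat \<times> nat"

definition dominates :: "point \<Rightarrow> point \<Rightarrow> bool" where
  "dominates p q \<longleftrightarrow> p \<noteq> q \<and> fst q \<le> fst p \<and> snd q \<le> snd p"

definition skyline :: "point set \<Rightarrow> point set" where
  "skyline S = {p \<in> S. \<not> (\<exists>q\<in>S. dominates q p)}"

definition general_position :: "point set \<Rightarrow> bool" where
  "general_position P \<longleftrightarrow> inj_on fst P \<and> inj_on snd P"

definition inputs :: "nat \<Rightarrow> nat \<Rightarrow> point set set" where
  "inputs U n = {P. P \<subseteq> {..<U} \<times> {..<U} \<and> card P = n \<and> general_position P}"

definition top_open :: "nat \<Rightarrow> nat \<Rightarrow> nat \<Rightarrow> nat \<Rightarrow> point set" where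
  "top_open U \<alpha>1 \<alpha>2 \<beta> = {\<alpha>1..\<alpha>2} \<times> {\<beta>..U}"

definition range_skyline :: "point set \<Rightarrow> point set \<Rightarrow> point set" where
  "range_skyline P Q = skyline (P \<inter> Q)"


section \<open>The external memory machine\<close>

text \<open>
  Parameters: \<open>M\<close> words of memory, blocks of \<open>B\<close> words, words of \<open>w\<close> bits. Words are natural numbers
  below \<open>2 ^ w\<close>. Three words are the least memory that can hold a top-open query.
\<close>

definition em_machine :: "nat \<Rightarrow> nat \<Rightarrow> nat \<Rightarrow> bool" where
  "em_machine M B w \<longleftrightarrow> 1 \<le> B \<and> 2 * B \<le> M \<and> 3 \<le> M \<and> 1 \<le> w"

definition words :: "nat \<Rightarrow> nat \<Rightarrow> nat list \<Rightarrow> bool" where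
  "words w l xs \<longleftrightarrow> length xs = l \<and> (\<forall>x\<in>set xs. x < 2 ^ w)"

text \<open>The space of a structure is the length of its disk, a list of blocks.\<close>

definition is_disk :: "nat \<Rightarrow> nat \<Rightarrow> nat list list \<Rightarrow> bool" where
  "is_disk B w D \<longleftrightarrow> (\<forall>b\<in>set D. words w B b)"

text \<open>
  Between two I/Os a program replaces the memory contents by an arbitrary function of them (CPU time
  is free, all bit manipulation is allowed) and selects the next I/O. The memory is the only state of
  a program. \<open>Read a p\<close> copies disk block \<open>a\<close> to memory positions \<open>p, \<dots>, p + B - 1\<close>, \<open>Write a p\<close>
  copies in the opposite direction, and \<open>Report p j\<close> writes the \<open>j \<le> B\<close> words of memory from position
  \<open>p\<close> on to a fresh block of the output. Each of the three costs one I/O.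
\<close>

datatype instr = Read nat nat | Write nat nat | Report nat nat | Halt

type_synonym program = "nat list \<Rightarrow> nat list \<times> instr"

definition store :: "nat \<Rightarrow> nat list \<Rightarrow> nat list \<Rightarrow> nat list" where
  "store p b m = take p m @ b @ drop (p + length b) m"

text \<open>
  \<open>run M B w f m D D' out t\<close>: started with memory \<open>m\<close> and disk \<open>D\<close>, the program \<open>f\<close> halts after \<open>t\<close> I/Os,
  leaving the disk \<open>D'\<close> and having output the words \<open>out\<close>. A program whose memory does not consist
  of \<open>M\<close> words, or that addresses a position out of range, gets stuck and has no run.
\<close>

inductive run :: "nat \<Rightarrow> nat \<Rightarrow> nat \<Rightarrow> program \<Rightarrow> nat list \<Rightarrow> nat list list \<Rightarrow>
    nat list list \<Rightarrow> nat list \<Rightarrow> nat \<Rightarrow> bool"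
  for M B w :: nat and f :: program where
  run_halt: "f m = (m', Halt) \<Longrightarrow> run M B w f m D D [] 0"
| run_read: "f m = (m', Read a p) \<Longrightarrow> words w M m' \<Longrightarrow> a < length D \<Longrightarrow> p + B \<le> M \<Longrightarrow>
    run M B w f (store p (D ! a) m') D D' out t \<Longrightarrow>
    run M B w f m D D' out (Suc t)"
| run_write: "f m = (m', Write a p) \<Longrightarrow> words w M m' \<Longrightarrow> a < length D \<Longrightarrow> p + B \<le> M \<Longrightarrow>
    run M B w f m' (D[a := take B (drop p m')]) D' out t \<Longrightarrow>
    run M B w f m D D' out (Suc t)"
| run_report: "f m = (m', Report p j) \<Longrightarrow> words w M m' \<Longrightarrow> j \<le> B \<Longrightarrow> p + j \<le> M \<Longrightarrow>
    run M B w f m' D D' out t \<Longrightarrow>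
    run M B w f m D D' (take j (drop p m') @ out) (Suc t)"

lemma run_deterministic:
  assumes "run M B w f m D D1 out1 t1" and "run M B w f m D D2 out2 t2"
  shows "D1 = D2 \<and> out1 = out2 \<and> t1 = t2"
  using assms
proof (induction arbitrary: D2 out2 t2)
  case (run_halt m m' D)
  from run_halt.prems show ?case
    by (cases rule: run.cases) (use run_halt.hyps in auto)
next
  case (run_read m m' a p D D' out t)
  from run_read.prems show ?case
    by (cases rule: run.cases) (use run_read.hyps in \<open>simp_all, blast dest: run_read.IH\<close>)
next
  case (run_write m m' a p D D' out t)
  from run_write.prems show ?case
    by (cases rule: run.cases) (use run_write.hyps in \<open>simp_all, blast dest: run_write.IH\<close>)
next
  case (run_report m m' p j D D' out t)
  from run_report.prems show ?case
    by (cases rule: run.cases) (use run_report.hyps in \<open>simp_all, blast dest: run_report.IH\<close>)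
qed


section \<open>Answering queries\<close>

text \<open>At the start of a query the memory contains the query and nothing else.\<close>

definition query_memory :: "nat \<Rightarrow> nat \<Rightarrow> nat \<Rightarrow> nat \<Rightarrow> nat list" where
  "query_memory M \<alpha>1 \<alpha>2 \<beta> = [\<alpha>1, \<alpha>2, \<beta>] @ replicate (M - 3) 0"

text \<open>Every point is output exactly once, in any order, as one word per coordinate.\<close>

definition lists_points :: "nat list \<Rightarrow> point set \<Rightarrow> bool" where
  "lists_points out S \<longleftrightarrow>
     (\<exists>ps. distinct ps \<and> set ps = S \<and> out = concat (map (\<lambda>(x, y). [x, y]) ps))"

definition answers :: "nat \<Rightarrow> nat \<Rightarrow> nat \<Rightarrow> program \<Rightarrow> nat \<Rightarrow> point set \<Rightarrow> nat list list \<Rightarrow>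
    nat \<Rightarrow> nat \<Rightarrow> nat \<Rightarrow> nat list list \<Rightarrow> nat \<Rightarrow> bool" where
  "answers M B w f U P D \<alpha>1 \<alpha>2 \<beta> D' t \<longleftrightarrow>
     (\<exists>out. run M B w f (query_memory M \<alpha>1 \<alpha>2 \<beta>) D D' out t \<and>
            lists_points out (range_skyline P (top_open U \<alpha>1 \<alpha>2 \<beta>)))"

text \<open>
  A structure for all \<open>n\<close>-point inputs, with no restriction on its space or query cost: \<open>\<D> P\<close> is the
  disk built for \<open>P\<close>, and \<open>f\<close> is the query program. A query may modify the disk.
\<close>

definition skyline_structure :: "nat \<Rightarrow> nat \<Rightarrow> nat \<Rightarrow> nat \<Rightarrow> nat \<Rightarrow> program \<Rightarrow>
    (point set \<Rightarrow> nat list list) \<Rightarrow> bool" where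
  "skyline_structure M B w U n f \<D> \<longleftrightarrow>
     (\<forall>P\<in>inputs U n. is_disk B w (\<D> P) \<and>
        (\<forall>\<alpha>1<U. \<forall>\<alpha>2<U. \<forall>\<beta><U. \<exists>D' t. answers M B w f U P (\<D> P) \<alpha>1 \<alpha>2 \<beta> D' t))"

end

theory Submission
  imports Defs
begin

text \<open>
  Let \<open>h x\<close> be one more than the height of the point in column \<open>x\<close>, and 0 if there is none. The answer to a
  query consists of the strict right-to-left maxima of \<open>h\<close> on \<open>[\<alpha>1, \<alpha>2]\<close> that exceed \<open>\<beta>\<close>. It suffices to
  find the \<open>b = \<Theta>(B)\<close> leftmost (that is, highest) of them in \<open>O(1)\<close> I/Os: if all of them exceed \<open>\<beta>\<close>, they pay
  for the round, and the search continues to the right of the last one. Columns are grouped into chunks of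
  \<open>b * w\<close>. The chunks strictly between those of \<open>\<alpha>1\<close> and \<open>\<alpha>2\<close> are covered by two overlapping entries of a
  sparse table, which has at most \<open>w\<close> levels and hence \<open>O(U / b)\<close> entries of \<open>b\<close> columns. In the two
  remaining chunks the positions of all maxima are determined by a Cartesian-tree shape of \<open>2 * b * w\<close> bits, that
  is \<open>2 * b\<close> words. Once the positions are known, at most \<open>b\<close> consecutive maxima are fetched in \<open>O(1)\<close> I/Os: those
  in the block of \<open>b\<close> columns of the last one lie together, and all others are among the last \<open>2 * b\<close> maxima at
  the end of the block in which the last of these others lies.

  For the lower bound, an antichain forces the output of \<open>2 * k\<close> words, and a program that makes no I/O on
  an empty answer cannot distinguish inputs.
\<close>

section \<open>Right-to-left maxima\<close>

definition rmax :: "(nat \<Rightarrow> nat) \<Rightarrow> nat \<Rightarrow> nat \<Rightarrow> nat set" where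
  "rmax h a t = {x \<in> {a..t}. \<forall>x'\<in>{x<..t}. h x' < h x}"

text \<open>Selection is by rank, so a set with fewer than \<open>b\<close> elements is selected
  entirely.\<close>

definition firsts :: "nat \<Rightarrow> nat set \<Rightarrow> nat set" where
  "firsts b A = {x \<in> A. card {y \<in> A. y < x} < b}"

definition lasts :: "nat \<Rightarrow> nat set \<Rightarrow> nat set" where
  "lasts b A = {x \<in> A. card {y \<in> A. x < y} < b}"

lemma finite_rmax [simp]: "finite (rmax h a t)"
  by (simp add: rmax_def)

lemma rmax_subset: "rmax h a t \<subseteq> {a..t}"
  by (auto simp: rmax_def)

lemma rmax_self: "a \<le> t \<Longrightarrow> t \<in> rmax h a t"
  by (auto simp: rmax_def)

text \<open>Being a maximum depends only on the columns to the right, so moving the left end merely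
  truncates the set. Hence maxima computed from a fixed start serve every query.\<close>

lemma rmax_restrict: "s \<le> a \<Longrightarrow> rmax h a t = rmax h s t \<inter> {a..}"
  by (auto simp: rmax_def)

lemma rmax_strict_antimono:
  "x \<in> rmax h a t \<Longrightarrow> y \<in> rmax h a t \<Longrightarrow> x < y \<Longrightarrow> h y < h x"
  by (auto simp: rmax_def)

lemma firsts_subset: "firsts b A \<subseteq> A"
  by (auto simp: firsts_def)

lemma finite_firsts: "finite A \<Longrightarrow> finite (firsts b A)"
  by (auto simp: firsts_def)

text \<open>The largest selected element has fewer than \<open>b\<close> elements of
  \<open>A\<close> below it, and every other selected element is one of these.\<close>

lemma card_firsts_le:
  assumes "finite A" shows "card (firsts b A) \<le> b"
proof (cases "firsts b A = {}")
  case False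
  let ?m = "Max (firsts b A)"
  have fin: "finite (firsts b A)" using assms by (rule finite_firsts)
  have m: "?m \<in> firsts b A" using fin False by (rule Max_in)
  have "firsts b A \<subseteq> insert ?m {y \<in> A. y < ?m}"
  proof
    fix x assume x: "x \<in> firsts b A"
    then have "x \<le> ?m" by (rule Max_ge[OF fin])
    moreover have "x \<in> A" using x firsts_subset by blast
    ultimately show "x \<in> insert ?m {y \<in> A. y < ?m}" by (auto simp: le_less)
  qed
  then have "card (firsts b A) \<le> card (insert ?m {y \<in> A. y < ?m})"
    using assms by (intro card_mono) auto
  also have "\<dots> \<le> Suc (card {y \<in> A. y < ?m})" using assms by (simp add: card_insert_if)
  also have "\<dots> \<le> b" using m by (simp add: firsts_def)
  finally show ?thesis .
qed simp

lemma card_lasts_le: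
  assumes "finite A" shows "card (lasts b A) \<le> b"
proof (cases "lasts b A = {}")
  case False
  let ?m = "Min (lasts b A)"
  have fin: "finite (lasts b A)" using assms by (simp add: lasts_def)
  have m: "?m \<in> lasts b A" using fin False by (rule Min_in)
  have "lasts b A \<subseteq> insert ?m {y \<in> A. ?m < y}"
  proof
    fix x assume x: "x \<in> lasts b A"
    then have "?m \<le> x" by (rule Min_le[OF fin])
    moreover have "x \<in> A" using x by (simp add: lasts_def)
    ultimately show "x \<in> insert ?m {y \<in> A. ?m < y}" by (auto simp: le_less)
  qed
  then have "card (lasts b A) \<le> card (insert ?m {y \<in> A. ?m < y})"
    using assms by (intro card_mono) auto
  also have "\<dots> \<le> Suc (card {y \<in> A. ?m < y})" using assms by (simp add: card_insert_if)
  also have "\<dots> \<le> b" using m by (simp add: lasts_def)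
  finally show ?thesis .
qed simp

lemma firsts_downward:
  assumes "finite A" "x \<in> firsts b A" "y \<in> A" "y \<le> x" shows "y \<in> firsts b A"
proof -
  have "card {z \<in> A. z < y} \<le> card {z \<in> A. z < x}"
    using assms by (intro card_mono) auto
  then show ?thesis using assms by (auto simp: firsts_def)
qed

text \<open>The least rejected element has only selected elements of \<open>A\<close> below it. Were
  these fewer than \<open>b\<close>, it would be selected itself.\<close>

lemma card_firsts_eq:
  assumes "finite A" "x \<in> A" "x \<notin> firsts b A"
  shows "card (firsts b A) = b" and "\<forall>y\<in>firsts b A. y < x"
proof -
  have lt: "\<forall>y\<in>firsts b A. y < x"
    using assms firsts_downward by (meson not_le_imp_less)
  show "\<forall>y\<in>firsts b A. y < x" by (rule lt)
  have "b \<le> card (firsts b A)"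
  proof (rule ccontr)
    assume less: "\<not> b \<le> card (firsts b A)"
    let ?R = "A - firsts b A"
    have fin: "finite ?R" and ne: "?R \<noteq> {}" using assms by auto
    have mR: "Min ?R \<in> ?R" using Min_in[OF fin ne] .
    have "{y \<in> A. y < Min ?R} \<subseteq> firsts b A"
      using Min_le[OF fin] by force
    then have "card {y \<in> A. y < Min ?R} \<le> card (firsts b A)"
      using assms finite_firsts by (intro card_mono) auto
    then have "Min ?R \<in> firsts b A" using less mR by (auto simp: firsts_def)
    with mR show False by blast
  qed
  then show "card (firsts b A) = b" using card_firsts_le[OF assms(1)] by (simp add: le_antisym)
qed

lemma firsts_eq_self: "finite A \<Longrightarrow> card (firsts b A) < b \<Longrightarrow> firsts b A = A"
  using card_firsts_eq(1)[of A _ b] firsts_subset by (metis nat_neq_iff subsetI subset_antisym)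

text \<open>A maximum of the small interval to the left of \<open>x\<close> is higher than
  \<open>x\<close>, which in turn is higher than everything behind it in \<open>{a..t}\<close>. So
  it is also a maximum of the large interval, and the rank of \<open>x\<close> cannot grow.\<close>

lemma firsts_subinterval:
  assumes "x \<in> firsts b (rmax h a t)" "l \<le> x" "x \<le> u" "a \<le> l" "u \<le> t"
  shows "x \<in> firsts b (rmax h l u)"
proof -
  have x: "x \<in> rmax h a t" using assms by (auto simp: firsts_def)
  have "{y \<in> rmax h l u. y < x} \<subseteq> {y \<in> rmax h a t. y < x}"
  proof safe
    fix y assume y: "y \<in> rmax h l u" "y < x"
    have "h x < h y" using y assms by (auto simp: rmax_def)
    moreover have "h z < h y" if "y < z" "z \<le> t" for z
    proof (cases "z \<le> u")
      case True with y that show ?thesis by (auto simp: rmax_def)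
    next
      case False
      then have "h z < h x" using x that assms by (auto simp: rmax_def)
      with \<open>h x < h y\<close> show ?thesis by simp
    qed
    ultimately show "y \<in> rmax h a t" using y assms by (auto simp: rmax_def)
  qed
  then have "card {y \<in> rmax h l u. y < x} \<le> card {y \<in> rmax h a t. y < x}"
    by (intro card_mono) auto
  then show ?thesis using assms x by (auto simp: firsts_def rmax_def)
qed

text \<open>Heights decrease along the maxima, so those above \<beta> come first and keep their
  ranks.\<close>

lemma firsts_threshold:
  "firsts b {x \<in> rmax h a t. \<beta> < h x} \<subseteq> firsts b (rmax h a t)"
proof
  fix x assume x: "x \<in> firsts b {x \<in> rmax h a t. \<beta> < h x}"
  then have "{y \<in> rmax h a t. y < x} = {y \<in> {x \<in> rmax h a t. \<beta> < h x}. y < x}"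
    using rmax_strict_antimono by (fastforce simp: firsts_def)
  with x show "x \<in> firsts b (rmax h a t)" by (simp add: firsts_def)
qed

section \<open>Covering the first maxima by one block and one snapshot\<close>

definition row_end :: "nat \<Rightarrow> nat set \<Rightarrow> nat" where
  "row_end b R = Max (firsts b R)"

text \<open>If no maximum precedes the block of \<open>row_end b R\<close>, the default keeps the
  value in \<open>R\<close>, so that its row exists on the disk.\<close>

definition row_rest :: "nat \<Rightarrow> nat set \<Rightarrow> nat" where
  "row_rest b R = (let e = row_end b R; S = {x \<in> R. x < e div b * b} in
     if S = {} then e else Max S)"

text \<open>The left end is 0 because it only truncates the set: one snapshot at the end of each
  block serves all queries.\<close>

definition snapshot :: "nat \<Rightarrow> (nat \<Rightarrow> nat) \<Rightarrow> nat \<Rightarrow> nat set" where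
  "snapshot b h r = lasts (2 * b) (rmax h 0 (r * b + b - 1))"

lemma row_end_in:
  assumes "a \<le> t" "1 \<le> b"
  shows "row_end b (rmax h a t) \<in> firsts b (rmax h a t)"
proof -
  have fin: "finite (rmax h a t)" by simp
  have ne: "rmax h a t \<noteq> {}" using rmax_self[OF assms(1)] by blast
  have "Min (rmax h a t) \<in> rmax h a t" using Min_in[OF fin ne] .
  moreover have "{y \<in> rmax h a t. y < Min (rmax h a t)} = {}"
    using Min_le[OF fin] by (auto simp: not_less)
  ultimately have "Min (rmax h a t) \<in> firsts b (rmax h a t)"
    using assms(2) unfolding firsts_def mem_Collect_eq by (simp only: card.empty) simp
  then have "firsts b (rmax h a t) \<noteq> {}" by blast
  then show ?thesis unfolding row_end_def by (intro Max_in finite_firsts) auto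
qed

lemma row_rest_in:
  assumes "a \<le> t" "1 \<le> b"
  shows "row_rest b (rmax h a t) \<in> rmax h a t"
proof -
  let ?S = "{x \<in> rmax h a t. x < row_end b (rmax h a t) div b * b}"
  have "Max ?S \<in> ?S" if "?S \<noteq> {}" using that by (intro Max_in) auto
  then show ?thesis using row_end_in[OF assms, of h] firsts_subset[of b "rmax h a t"]
    unfolding row_rest_def Let_def by auto
qed

text \<open>Let \<open>e'\<close> be the last maximum before the block of
  \<open>row_end b R\<close>, and \<tau> the end of the block of \<open>e'\<close>. A selected
  \<open>x\<close> before the block of \<open>row_end b R\<close> is still a maximum at time \<tau>.
  The maxima behind it are either among the at most \<open>b - 1\<close> columns after
  \<open>e'\<close> up to \<tau>, or selected themselves, which leaves at most \<open>b - 1\<close>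
  more. So \<open>x\<close> is among the last \<open>2 * b\<close>.\<close>

lemma firsts_cover:
  fixes h :: "nat \<Rightarrow> nat"
  assumes at: "a \<le> t" and b: "1 \<le> b"
  defines "R \<equiv> rmax h a t"
  defines "r \<equiv> row_end b R div b"
  shows "firsts b R \<subseteq> {r * b..<r * b + b} \<union> snapshot b h (row_rest b R div b)"
proof
  fix x assume x: "x \<in> firsts b R"
  let ?e = "row_end b R"
  have e: "?e \<in> firsts b R" unfolding R_def using row_end_in[OF at b] .
  have eR: "?e \<in> R" using e firsts_subset by auto
  have xe: "x \<le> ?e" unfolding row_end_def using x by (intro Max_ge finite_firsts) (auto simp: R_def)
  have xR: "x \<in> R" using x firsts_subset by auto
  have eub: "?e < r * b + b" unfolding r_def using b
    using div_mult_mod_eq[of ?e b] mod_less_divisor[of b ?e] by linarith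
  show "x \<in> {r * b..<r * b + b} \<union> snapshot b h (row_rest b R div b)"
  proof (cases "r * b \<le> x")
    case True then show ?thesis using xe eub by auto
  next
    case False
    let ?S = "{x \<in> R. x < r * b}"
    define e' where "e' = row_rest b R"
    have xS: "x \<in> ?S" using False xR by auto
    have finS: "finite ?S" by (simp add: R_def)
    have e': "e' = Max ?S" using xS unfolding e'_def row_rest_def r_def Let_def by auto
    have e'S: "e' \<in> ?S" unfolding e' using finS xS by (intro Max_in) blast+
    have xe': "x \<le> e'" unfolding e' using finS xS by (intro Max_ge)
    define k where "k = e' div b"
    define \<tau> where "\<tau> = k * b + b - 1"
    have kb: "k * b \<le> e'" "e' \<le> \<tau>" unfolding k_def \<tau>_def
      using b div_mult_mod_eq[of e' b] mod_less_divisor[of b e'] by linarith+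
    have "k < r"
    proof -
      have "k * b < r * b" using le_less_trans[OF kb(1)] e'S by blast
      then show ?thesis by simp
    qed
    then have "(k + 1) * b \<le> r * b" by (intro mult_right_mono) auto
    moreover have "r * b \<le> ?e" unfolding r_def by simp
    ultimately have \<tau>e: "\<tau> < ?e" unfolding \<tau>_def using b by (simp add: algebra_simps)
    have et: "?e \<le> t" using eR rmax_subset unfolding R_def by fastforce
    have ax: "a \<le> x" using xR rmax_subset unfolding R_def by fastforce
    have xh: "x \<in> rmax h 0 \<tau>"
    proof -
      have "x \<le> \<tau>" using xe' kb(2) by simp
      moreover have "h z < h x" if "x < z" "z \<le> \<tau>" for z
      proof -
        have "z \<le> t" using that \<tau>e et by simp
        then show ?thesis using xR that by (simp add: R_def rmax_def)
      qed
      ultimately show ?thesis by (simp add: rmax_def)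
    qed
    have "{y \<in> rmax h 0 \<tau>. x < y} \<subseteq> {e'<..\<tau>} \<union> {y \<in> firsts b R. x < y}"
    proof
      fix y assume "y \<in> {y \<in> rmax h 0 \<tau>. x < y}"
      then have y: "y \<in> rmax h 0 \<tau>" "x < y" by auto
      show "y \<in> {e'<..\<tau>} \<union> {y \<in> firsts b R. x < y}"
      proof (cases "e' < y")
        case True then show ?thesis using y rmax_subset by fastforce
      next
        case False
        have "h z < h y" if "y < z" "z \<le> t" for z
        proof (cases "z \<le> \<tau>")
          case True then show ?thesis using y that by (auto simp: rmax_def)
        next
          case 2: False
          \<comment> \<open>Behind \<tau> the comparison goes through \<open>e'\<close>, which is
            higher than everything to its right up to \<open>t\<close>.\<close>
          have "h z < h e'" using e'S 2 that kb unfolding R_def rmax_def by auto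
          also have "h e' \<le> h y"
          proof (cases "y = e'")
            case False
            then show ?thesis using y \<open>\<not> e' < y\<close> kb unfolding rmax_def by (intro less_imp_le) auto
          qed simp
          finally show ?thesis .
        qed
        moreover have "a \<le> y" "y \<le> t" using y(2) ax False kb \<tau>e et by simp_all
        ultimately have "y \<in> R" by (simp add: R_def rmax_def)
        moreover have "y \<le> ?e" using False kb \<tau>e by simp
        ultimately have "y \<in> firsts b R" using e by (intro firsts_downward[of R ?e b y]) (auto simp: R_def)
        then show ?thesis using y by auto
      qed
    qed
    then have "card {y \<in> rmax h 0 \<tau>. x < y} \<le> card ({e'<..\<tau>} \<union> {y \<in> firsts b R. x < y})"
      by (intro card_mono) (auto simp: R_def finite_firsts)
    also have "\<dots> \<le> card {e'<..\<tau>} + card {y \<in> firsts b R. x < y}" by (rule card_Un_le)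
    also have "card {e'<..\<tau>} \<le> b - 1" using kb unfolding \<tau>_def by simp
    also have "card {y \<in> firsts b R. x < y} < card (firsts b R)"
      using x by (intro psubset_card_mono) (auto simp: R_def finite_firsts)
    also have "card (firsts b R) \<le> b" by (rule card_firsts_le) (simp add: R_def)
    finally have "card {y \<in> rmax h 0 \<tau>. x < y} < 2 * b" by simp
    then have "x \<in> snapshot b h k" unfolding snapshot_def lasts_def \<tau>_def[symmetric] using xh by simp
    then show ?thesis unfolding k_def e'_def by blast
  qed
qed

section \<open>Selecting from partially known heights\<close>

lemma rmax_above:
  assumes "a \<le> x" "x \<le> t" "x \<notin> rmax h a t"
  obtains z where "x < z" "z \<in> rmax h a t" "h x \<le> h z"
proof -
  \<comment> \<open>Among the later columns at least as high as \<open>x\<close>, the rightmost of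
    greatest height is a maximum.\<close>
  let ?Z = "{z \<in> {x<..t}. h x \<le> h z}"
  have "?Z \<noteq> {}" "finite ?Z" using assms by (auto simp: rmax_def not_less)
  then have "Max (h ` ?Z) \<in> h ` ?Z" by (intro Max_in) auto
  then obtain z0 where z0_in: "z0 \<in> ?Z" and z0_eq: "h z0 = Max (h ` ?Z)" by auto
  have z0: "z0 \<in> ?Z" "\<forall>z\<in>?Z. h z \<le> h z0"
    using z0_in \<open>finite ?Z\<close> unfolding z0_eq by auto
  let ?Y = "{z \<in> ?Z. h z = h z0}"
  have fY: "finite ?Y" and nY: "?Y \<noteq> {}" using z0 by auto
  let ?z = "Max ?Y"
  have z: "?z \<in> ?Y" using Max_in[OF fY nY] .
  have "h y < h ?z" if "?z < y" "y \<le> t" for y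
  proof (rule ccontr)
    assume "\<not> h y < h ?z"
    then have "h ?z \<le> h y" by simp
    then have "y \<in> ?Z" using z z0 that by auto
    moreover have "h y = h z0" using z0(2) \<open>y \<in> ?Z\<close> \<open>h ?z \<le> h y\<close> z by fastforce
    ultimately have "y \<le> ?z" using fY by (intro Max_ge) auto
    with that show False by simp
  qed
  then have "?z \<in> rmax h a t" using z assms by (auto simp: rmax_def)
  with z show ?thesis by (intro that[of ?z]) auto
qed

text \<open>The program knows the heights only on the set \<open>X\<close> of columns that it has
  read. Hiding the others can create false maxima, but these all come after \<open>b\<close> true
  ones and are not selected.\<close>

lemma firsts_partial:
  fixes h :: "nat \<Rightarrow> nat" and a t \<beta> :: nat
  defines "G \<equiv> {x \<in> rmax h a t. \<beta> < h x}"
  assumes X: "firsts b G \<subseteq> X"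
  defines "g \<equiv> \<lambda>x. if x \<in> X then h x else 0"
  shows "firsts b {x \<in> rmax g a t. \<beta> < g x} = firsts b G"
proof -
  define G' where "G' = {x \<in> rmax g a t. \<beta> < g x}"
  have finG: "finite G" and finG': "finite G'" by (auto simp: G_def G'_def)
  have gh: "g x \<le> h x" for x by (simp add: g_def)
  have sub: "firsts b G \<subseteq> G'"
  proof
    fix x assume x: "x \<in> firsts b G"
    then have "x \<in> G" "x \<in> X" using X firsts_subset by auto
    then have "g x = h x" by (simp add: g_def)
    moreover have "g z < h x" if "x < z" "z \<le> t" for z
    proof -
      have "h z < h x" using \<open>x \<in> G\<close> that by (simp add: G_def rmax_def)
      then show ?thesis using gh[of z] by simp
    qed
    ultimately show "x \<in> G'" using \<open>x \<in> G\<close> by (simp add: G_def G'_def rmax_def)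
  qed
  \<comment> \<open>A false maximum \<open>x\<close> is beaten by a hidden true one,
    \<open>z\<close>. As \<open>z\<close> is hidden it is not selected, so the selection is full and
    its members are higher than \<open>z\<close>, hence than \<open>x\<close>. They are visible, so
    none of them can lie to the right of \<open>x\<close>.\<close>
  have new: "card (firsts b G) = b \<and> (\<forall>y\<in>firsts b G. y < x)" if x: "x \<in> G'" "x \<notin> G" for x
  proof -
    have xt: "a \<le> x" "x \<le> t" and g: "\<beta> < g x" "\<forall>z\<in>{x<..t}. g z < g x"
      using x(1) by (simp_all add: G'_def rmax_def)
    have xX: "x \<in> X" using g(1) unfolding g_def by (cases "x \<in> X") simp_all
    have gx: "g x = h x" "\<beta> < h x" using xX g(1) by (simp_all add: g_def)
    have "x \<notin> rmax h a t" using x gx by (auto simp: G_def)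
    then obtain z where z: "x < z" "z \<in> rmax h a t" "h x \<le> h z"
      using rmax_above xt by metis
    have zG: "z \<in> G" using z gx by (simp add: G_def)
    have big: "h y < h x" if "y \<in> X" "x < y" "y \<le> t" for y
    proof -
      have "g y < g x" using g(2) that by simp
      then show ?thesis using that(1) gx(1) by (simp add: g_def)
    qed
    have "z \<notin> X" using big[of z] z rmax_subset[of h a t] by (auto simp: not_less)
    then have "z \<notin> firsts b G" using X by auto
    note c = card_firsts_eq[OF finG zG this]
    have "y < x" if y: "y \<in> firsts b G" for y
    proof -
      have yG: "y \<in> G" "y \<in> X" using y firsts_subset X by auto
      have "y < z" using c(2) y by auto
      then have "h z < h y" using rmax_strict_antimono[of y h a t z] yG z by (simp add: G_def)
      then have "\<not> h y < h x" using z(3) by simp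
      moreover have "y \<le> t" using yG rmax_subset[of h a t] by (auto simp: G_def)
      ultimately have "\<not> x < y" using big[of y] yG by blast
      moreover have "y \<noteq> x" using yG x by auto
      ultimately show ?thesis by simp
    qed
    with c(1) show ?thesis by simp
  qed
  show ?thesis unfolding G'_def[symmetric]
  proof (intro set_eqI iffI)
    fix x assume x: "x \<in> firsts b G"
    have "{y \<in> G'. y < x} \<subseteq> {y \<in> G. y < x}"
    proof safe
      fix y assume y: "y \<in> G'" "y < x"
      show "y \<in> G"
      proof (rule ccontr)
        assume "y \<notin> G"
        then have "x < y" using new[OF y(1)] x by blast
        with y(2) show False by simp
      qed
    qed
    then have "card {y \<in> G'. y < x} \<le> card {y \<in> G. y < x}"
      using finG by (intro card_mono) auto
    then show "x \<in> firsts b G'" using x sub by (auto simp: firsts_def)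
  next
    fix x assume x: "x \<in> firsts b G'"
    show "x \<in> firsts b G"
    proof (rule ccontr)
      assume n: "x \<notin> firsts b G"
      have "card (firsts b G) = b \<and> (\<forall>y\<in>firsts b G. y < x)"
      proof (cases "x \<in> G")
        case True then show ?thesis using card_firsts_eq[OF finG True n] by simp
      next
        case False then show ?thesis using new x firsts_subset by blast
      qed
      then have "firsts b G \<subseteq> {y \<in> G'. y < x}" "card (firsts b G) = b" using sub by auto
      then have "b \<le> card {y \<in> G'. y < x}" using card_mono[of "{y \<in> G'. y < x}" "firsts b G"] finG' by simp
      with x show False by (simp add: firsts_def)
    qed
  qed
qed

section \<open>Encoding the shape of a chunk\<close>

text \<open>
  Sweeping over the columns, the set of maxima is a stack. The set below records the times of the
  pushes in the sequence of all pushes and pops; their distances tell the number of pops.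
\<close>

definition shape :: "nat \<Rightarrow> (nat \<Rightarrow> nat) \<Rightarrow> nat \<Rightarrow> nat set" where
  "shape L h s = (\<lambda>i. 2 * i + 1 - card (rmax h s (s + i))) ` {..<L}"

lemma card_rmax_le: "card (rmax h s (s + i)) \<le> Suc i"
  using card_mono[OF _ rmax_subset[of h s "s + i"]] by simp

lemma rmax_Suc:
  "s \<le> Suc t \<Longrightarrow> rmax h s (Suc t) = insert (Suc t) {x \<in> rmax h s t. h (Suc t) < h x}"
  by (auto simp: rmax_def le_Suc_eq)

text \<open>Two initial segments of a finite linear order are nested, so equal cardinality makes
  them equal.\<close>

lemma downset_eq:
  fixes X Y :: "nat set"
  assumes "finite A" "X \<subseteq> A" "Y \<subseteq> A"
    and "\<And>x y. x \<in> X \<Longrightarrow> y \<in> A \<Longrightarrow> y \<le> x \<Longrightarrow> y \<in> X"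
    and "\<And>x y. x \<in> Y \<Longrightarrow> y \<in> A \<Longrightarrow> y \<le> x \<Longrightarrow> y \<in> Y"
    and "card X = card Y"
  shows "X = Y"
proof -
  have fin: "finite X" "finite Y" using assms(1-3) finite_subset by blast+
  have "X \<subseteq> Y \<or> Y \<subseteq> X"
    using assms(2-5) by (meson linear subset_eq)
  then show ?thesis using fin assms(6) card_subset_eq by metis
qed

text \<open>The push times increase strictly, so their set recovers their sequence and with it the
  stack sizes. By induction the stacks agree: heights decrease along the stack, so the columns
  surviving the pops form an initial segment, which its size determines.\<close>

lemma shape_determines:
  assumes eq: "shape L h s = shape L h' s" and t: "t < L"
  shows "rmax h s (s + t) = rmax h' s (s + t)"
proof -
  define c where "c h i = card (rmax h s (s + i))" for h i
  \<comment> \<open>After column \<open>s + i\<close> there have been \<open>i + 1\<close> pushes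
    and \<open>i + 1 - c h i\<close> pops, so the push of this column is operation number
    \<open>2 * i + 1 - c h i\<close>, counted from 0.\<close>
  define p where "p h i = 2 * i + 1 - c h i" for h i
  have c1: "1 \<le> c h i" for h i
    unfolding c_def using rmax_self[of s "s + i" h] by (metis card_gt_0_iff finite_rmax empty_iff le_add1 Suc_leI One_nat_def)
  have cle: "c h i \<le> i + 1" for h i unfolding c_def using card_rmax_le by simp
  have cSuc: "c h (Suc i) \<le> c h i + 1" for h i
  proof -
    have "c h (Suc i) \<le> Suc (card {x \<in> rmax h s (s + i). h (Suc (s + i)) < h x})"
      unfolding c_def using rmax_Suc[of s "s + i" h] by (simp add: card_insert_if)
    also have "card {x \<in> rmax h s (s + i). h (Suc (s + i)) < h x} \<le> c h i"
      unfolding c_def by (intro card_mono) auto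
    finally show ?thesis by simp
  qed
  have mono: "strict_mono (p h)" for h
    unfolding strict_mono_Suc_iff p_def
  proof
    fix i show "2 * i + 1 - c h i < 2 * Suc i + 1 - c h (Suc i)"
      using cSuc[of h i] cle[of h i] cle[of h "Suc i"] by simp
  qed
  have sorted: "sorted (map (p h) [0..<L])" "distinct (map (p h) [0..<L])" for h
    using mono[of h] by (auto simp: sorted_map sorted_wrt_iff_nth_less strict_mono_less_eq distinct_map
      intro!: strict_mono_imp_inj_on[THEN inj_on_subset])
  have "set (map (p h) [0..<L]) = set (map (p h') [0..<L])"
    using eq by (simp add: shape_def p_def c_def atLeast0LessThan)
  then have maps: "map (p h) [0..<L] = map (p h') [0..<L]"
    using sorted sorted_distinct_set_unique by blast
  have ceq: "c h i = c h' i" if "i < L" for i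
  proof -
    have "p h i = p h' i" using maps that by (metis add_0 nth_map_upt minus_nat.diff_0)
    then show ?thesis using cle[of h i] cle[of h' i] unfolding p_def by arith
  qed
  show ?thesis using t
  proof (induction t)
    case 0 show ?case by (auto simp: rmax_def)
  next
    case (Suc t)
    let ?A = "rmax h s (s + t)"
    let ?X = "\<lambda>h. {x \<in> ?A. h (Suc (s + t)) < h x}"
    have IH: "?A = rmax h' s (s + t)" using Suc by simp
    have nin: "Suc (s + t) \<notin> ?A" using rmax_subset by fastforce
    have R: "rmax h s (s + Suc t) = insert (Suc (s + t)) (?X h)"
            "rmax h' s (s + Suc t) = insert (Suc (s + t)) (?X h')"
      using rmax_Suc[of s "s + t"] IH by simp_all
    have "c h (Suc t) = c h' (Suc t)" using ceq Suc by simp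
    then have "card (?X h) = card (?X h')"
      unfolding c_def R using nin by simp
    then have "?X h = ?X h'"
    proof (rule downset_eq[rotated 5])
      fix x y assume "x \<in> ?X h" "y \<in> ?A" "y \<le> x"
      then show "y \<in> ?X h" using rmax_strict_antimono[of y h s "s + t" x] by (cases "x = y") auto
    next
      fix x y assume "x \<in> ?X h'" "y \<in> ?A" "y \<le> x"
      then show "y \<in> ?X h'" using rmax_strict_antimono[of y h' s "s + t" x] IH by (cases "x = y") auto
    qed auto
    then show ?case using R by simp
  qed
qed

lemma shape_bounded: "shape L h s \<subseteq> {..<2 * L}"
proof -
  have "2 * i + 1 - card (rmax h s (s + i)) < 2 * L" if "i < L" for i
  proof -
    have "1 \<le> card (rmax h s (s + i))"
      using rmax_self[of s "s + i" h] by (metis card_gt_0_iff finite_rmax empty_iff le_add1 Suc_leI One_nat_def)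
    with that show ?thesis by simp
  qed
  then show ?thesis by (auto simp: shape_def)
qed

text \<open>By counting: there are \<open>2 ^ (l * w)\<close> lists of \<open>l\<close> words and
  equally many sets of \<open>l * w\<close> bit positions.\<close>

lemma words_encode_sets:
  "\<exists>e. inj_on e (Pow {..<l * w}) \<and> (\<forall>A \<in> Pow {..<l * w}. words w l (e A))"
proof -
  have eq: "{xs. words w l xs} = {xs. set xs \<subseteq> {..<2 ^ w} \<and> length xs = l}"
    by (auto simp: words_def)
  have "card {xs. words w l xs} = card (Pow {..<l * w})"
    unfolding eq by (simp add: card_lists_length_eq card_Pow power_mult[symmetric] mult.commute)
  moreover have "finite {xs. words w l xs}" unfolding eq by (rule finite_lists_length_eq) simp
  ultimately obtain e where "bij_betw e (Pow {..<l * w}) {xs. words w l xs}"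
    using finite_same_card_bij[of "Pow {..<l * w}" "{xs. words w l xs}"] by auto
  then show ?thesis by (auto simp: bij_betw_def)
qed

definition encode :: "nat \<Rightarrow> nat \<Rightarrow> nat set \<Rightarrow> nat list" where
  "encode w l = (SOME e. inj_on e (Pow {..<l * w}) \<and> (\<forall>A \<in> Pow {..<l * w}. words w l (e A)))"

lemma encode: "inj_on (encode w l) (Pow {..<l * w})" "A \<subseteq> {..<l * w} \<Longrightarrow> words w l (encode w l A)"
  using someI_ex[OF words_encode_sets[of l w]] unfolding encode_def[symmetric] by auto

definition shape_code :: "nat \<Rightarrow> nat \<Rightarrow> (nat \<Rightarrow> nat) \<Rightarrow> nat \<Rightarrow> nat list" where
  "shape_code b w h s = encode w (2 * b) (shape (b * w) h s)"

text \<open>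
  Decoding returns some height function of the given shape. It has the right maxima in the chunk, but
  arbitrary heights.
\<close>

definition some_of_code :: "nat \<Rightarrow> nat \<Rightarrow> nat \<Rightarrow> nat list \<Rightarrow> nat \<Rightarrow> nat" where
  "some_of_code b w s W = (SOME h. shape_code b w h s = W)"

lemma words_shape_code: "words w (2 * b) (shape_code b w h s)"
  unfolding shape_code_def using shape_bounded[of "b * w" h s] by (intro encode(2)) (simp add: mult.assoc)

text \<open>The decoded function has the same code, by injectivity the same shape, and therefore the
  same maxima from the start \<open>s\<close> of the chunk on; \<open>rmax_restrict\<close> then
  moves the left end to \<open>a\<close>.\<close>

lemma rmax_some_of_code:
  assumes "s \<le> a" "t < s + b * w"
  shows "rmax (some_of_code b w s (shape_code b w h s)) a t = rmax h a t"
proof (cases "a \<le> t")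
  case True
  let ?h = "some_of_code b w s (shape_code b w h s)"
  have "shape_code b w ?h s = shape_code b w h s"
    unfolding some_of_code_def by (rule someI[where P = "\<lambda>h'. shape_code b w h' s = shape_code b w h s"]) (rule refl)
  then have "shape (b * w) ?h s = shape (b * w) h s"
    unfolding shape_code_def using shape_bounded[of "b * w" _ s]
    by (intro inj_onD[OF encode(1)[of w "2 * b"]]) (auto simp: mult.assoc)
  from shape_determines[OF this, of "t - s"] assms True
  have "rmax ?h s t = rmax h s t" by simp
  then show ?thesis using rmax_restrict[OF assms(1)] by simp
qed (simp add: rmax_def)

section \<open>Rows that cover a query\<close>

definition column :: "point set \<Rightarrow> nat \<Rightarrow> nat" where
  "column P x = (if \<exists>y. (x, y) \<in> P then Suc (THE y. (x, y) \<in> P) else 0)"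

definition top_point :: "(nat \<Rightarrow> nat) \<Rightarrow> nat \<Rightarrow> point" where
  "top_point h x = (x, h x - 1)"

lemma column_eq:
  assumes "inj_on fst P" "(x, y) \<in> P" shows "column P x = Suc y"
proof -
  have "(THE y. (x, y) \<in> P) = y"
  proof (rule the_equality)
    fix z assume "(x, z) \<in> P"
    then have "(x, z) = (x, y)" using assms by (intro inj_onD[OF assms(1)]) auto
    then show "z = y" by simp
  qed (rule assms(2))
  then show ?thesis using assms(2) by (auto simp: column_def)
qed

lemma top_point_in: "inj_on fst P \<Longrightarrow> 0 < column P x \<Longrightarrow> top_point (column P) x \<in> P"
  using column_eq unfolding top_point_def by (fastforce simp: column_def split: if_splits)

text \<open>Brings the heights of the points that were read into the form of the function
  \<open>g\<close> in \<open>firsts_partial\<close>.\<close>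

lemma column_top_points:
  assumes "\<And>x. x \<in> X \<Longrightarrow> 0 < h x"
  shows "column (top_point h ` X) = (\<lambda>x. if x \<in> X then h x else 0)"
proof
  fix x
  have inj: "inj_on fst (top_point h ` X)" by (auto simp: inj_on_def top_point_def)
  show "column (top_point h ` X) x = (if x \<in> X then h x else 0)"
  proof (cases "x \<in> X")
    case True
    then have "(x, h x - 1) \<in> top_point h ` X" by (auto simp: top_point_def)
    then show ?thesis using column_eq[OF inj] True assms[OF True] by simp
  next
    case False
    then show ?thesis by (auto simp: column_def top_point_def)
  qed
qed

text \<open>A dominating point is at least as high and therefore meets the lower edge too, so
  \<beta> can be applied after the maxima have been taken. Because heights are shifted by one, the
  strict test \<open>\<beta> < column P x\<close> means a y-coordinate of at least \<beta> and
  excludes empty columns.\<close>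

lemma range_skyline_columns:
  assumes P: "inj_on fst P" "P \<subseteq> UNIV \<times> {..U}"
  shows "range_skyline P (top_open U a t \<beta>) =
    top_point (column P) ` {x \<in> rmax (column P) a t. \<beta> < column P x}"
proof (intro set_eqI iffI)
  fix p assume "p \<in> range_skyline P (top_open U a t \<beta>)"
  moreover obtain x y where p: "p = (x, y)" by (cases p)
  ultimately have xy: "(x, y) \<in> P" "a \<le> x" "x \<le> t" "\<beta> \<le> y"
    and max: "\<And>q. q \<in> P \<inter> top_open U a t \<beta> \<Longrightarrow> \<not> dominates q (x, y)"
    by (auto simp: range_skyline_def skyline_def top_open_def)
  have h: "column P x = Suc y" using column_eq P(1) xy(1) by blast
  have "column P z < column P x" if z: "x < z" "z \<le> t" for z
  proof (rule ccontr)
    assume "\<not> column P z < column P x"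
    then have ge: "Suc y \<le> column P z" using h by simp
    then have zP: "(z, column P z - 1) \<in> P" using top_point_in[OF P(1), of z] by (simp add: top_point_def)
    then have "(z, column P z - 1) \<in> P \<inter> top_open U a t \<beta>"
      using P(2) z xy ge by (auto simp: top_open_def)
    from max[OF this] z ge show False by (auto simp: dominates_def)
  qed
  then show "p \<in> top_point (column P) ` {x \<in> rmax (column P) a t. \<beta> < column P x}"
    using xy h p by (intro image_eqI[of _ _ x]) (auto simp: top_point_def rmax_def)
next
  fix p assume "p \<in> top_point (column P) ` {x \<in> rmax (column P) a t. \<beta> < column P x}"
  then obtain x where x: "x \<in> rmax (column P) a t" "\<beta> < column P x" and p: "p = top_point (column P) x"
    by auto
  have "p \<in> P" using top_point_in[OF P(1), of x] x p by simp
  then have pQ: "p \<in> P \<inter> top_open U a t \<beta>"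
    using x P(2) rmax_subset[of "column P" a t] p by (auto simp: top_open_def top_point_def)
  moreover have "\<not> dominates q p" if q: "q \<in> P \<inter> top_open U a t \<beta>" for q
  proof
    assume dom: "dominates q p"
    obtain z v where qz: "q = (z, v)" by (cases q)
    have "column P z = Suc v" using column_eq P(1) q qz by blast
    moreover have "z \<noteq> x"
      using dom q qz \<open>p \<in> P\<close> p inj_onD[OF P(1), of q p] by (auto simp: dominates_def top_point_def)
    ultimately have "x < z" "z \<le> t" "column P x \<le> column P z"
      using dom q qz p x by (auto simp: dominates_def top_point_def top_open_def)
    with x(1) show False by (simp add: rmax_def linorder_not_less[symmetric])
  qed
  ultimately show "p \<in> range_skyline P (top_open U a t \<beta>)"
    by (auto simp: range_skyline_def skyline_def)
qed

section \<open>The sparse table and the rows read for a query\<close>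

definition level :: "nat \<Rightarrow> nat" where
  "level n = (SOME j. 2 ^ j \<le> n \<and> n < 2 ^ (j + 1))"

text \<open>Thus \<open>level n\<close> is the integer part of the binary logarithm.\<close>

lemma level: assumes "1 \<le> n" shows "2 ^ level n \<le> n" "n < 2 * 2 ^ level n"
proof -
  have "\<exists>j. 2 ^ j \<le> n \<and> n < 2 ^ (j + 1)" using assms by (intro ex_power_ivl1) auto
  from someI_ex[OF this] show "2 ^ level n \<le> n" "n < 2 * 2 ^ level n"
    unfolding level_def[symmetric] by auto
qed

text \<open>If both ends of the query lie in one chunk, \<open>left_part\<close> and
  \<open>right_part\<close> both delimit the whole query, which spares a case distinction.\<close>

definition left_part :: "nat \<Rightarrow> nat \<Rightarrow> nat \<Rightarrow> nat" where
  "left_part L \<alpha>1 \<alpha>2 = min \<alpha>2 (\<alpha>1 div L * L + L - 1)"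

definition right_part :: "nat \<Rightarrow> nat \<Rightarrow> nat \<Rightarrow> nat" where
  "right_part L \<alpha>1 \<alpha>2 = max \<alpha>1 (\<alpha>2 div L * L)"

text \<open>
  The table entry for the \<open>2 ^ j\<close> chunks from chunk \<open>i\<close> on is kept in row \<open>i * w + j\<close>. If there is no chunk
  strictly inside, any existing row will do, since the program filters the points that it has read.
\<close>

definition table_row :: "nat \<Rightarrow> nat \<Rightarrow> nat \<Rightarrow> nat \<Rightarrow> bool \<Rightarrow> nat" where
  "table_row b w \<alpha>1 \<alpha>2 left = (let l = \<alpha>1 div (b * w) + 1; r = \<alpha>2 div (b * w); j = level (r - l) in
     if l < r then (if left then l else r - 2 ^ j) * w + j else \<alpha>1 div b)"

text \<open>Listed in reading order: an entry depends only on the query and on rows earlier in the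
  list. The sets \<open>R1\<close> and \<open>R2\<close> enter without their heights, so a decoded
  shape suffices to compute them.\<close>

definition rows :: "nat \<Rightarrow> nat \<Rightarrow> nat \<Rightarrow> nat \<Rightarrow> nat set \<Rightarrow> nat set \<Rightarrow> nat list" where
  "rows b w \<alpha>1 \<alpha>2 R1 R2 =
     [\<alpha>1 div b, row_end b R1 div b, row_rest b R1 div b,
      \<alpha>2 div b, row_end b R2 div b, row_rest b R2 div b,
      table_row b w \<alpha>1 \<alpha>2 True, table_row b w \<alpha>1 \<alpha>2 False]"

text \<open>The snapshot is split into groups 1 and 2 so that each group has at most
  \<open>b\<close> columns and fits a cell. Group 3 is the table entry of level
  \<open>r mod w\<close> at chunk \<open>r div w\<close>.\<close>

definition row_columns :: "nat \<Rightarrow> nat \<Rightarrow> (nat \<Rightarrow> nat) \<Rightarrow> nat \<Rightarrow> nat \<Rightarrow> nat set" where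
  "row_columns b w h r p =
     (if p = 0 then {r * b..<r * b + b}
      else if p = 1 then set (take b (sorted_list_of_set (snapshot b h r)))
      else if p = 2 then set (drop b (sorted_list_of_set (snapshot b h r)))
      else firsts b (rmax h (r div w * (b * w)) ((r div w + 2 ^ (r mod w)) * (b * w) - 1)))"

lemma finite_snapshot: "finite (snapshot b h r)"
  by (simp add: snapshot_def lasts_def)

lemma card_row_columns: "card (row_columns b w h r p) \<le> b"
proof -
  have "card (set (take b xs)) \<le> b" for xs :: "nat list"
    by (rule order_trans[OF card_length]) simp
  moreover have "card (set (drop b (sorted_list_of_set (snapshot b h r)))) \<le> b"
    using card_lasts_le[of "rmax h 0 (r * b + b - 1)" "2 * b"]
    by (intro order_trans[OF card_length]) (simp add: snapshot_def)
  ultimately show ?thesis by (simp add: row_columns_def card_firsts_le)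
qed

lemma finite_row_columns: "finite (row_columns b w h r p)"
  by (simp add: row_columns_def finite_firsts)

lemma snapshot_columns: "snapshot b h r = row_columns b w h r 1 \<union> row_columns b w h r 2"
  unfolding row_columns_def using finite_snapshot
  by (simp flip: set_append)

lemma level_less:
  assumes "1 \<le> n" "n < 2 ^ w" shows "level n < w"
  using level(1)[OF assms(1)] assms(2)
  by (metis le_less_trans one_less_numeral_iff power_less_imp_less_exp semiring_norm(76))

text \<open>A chunk has \<open>w\<close> blocks and hence \<open>w\<close> rows, one for each
  possible level. The first chunk of a table entry precedes the chunk of \<alpha>2, so its rows
  precede those of that chunk.\<close>

lemma table_row_le:
  assumes "1 \<le> b" "1 \<le> w" "\<alpha>1 \<le> \<alpha>2" "\<alpha>2 < 2 ^ w"
  shows "table_row b w \<alpha>1 \<alpha>2 left \<le> \<alpha>2 div b"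
proof -
  define l where "l = \<alpha>1 div (b * w) + 1"
  define r where "r = \<alpha>2 div (b * w)"
  show ?thesis
  proof (cases "l < r")
    case True
    have "r - l < 2 ^ w" using assms(4) unfolding r_def
      by (meson diff_le_self div_le_dividend le_less_trans)
    then have j: "level (r - l) < w" using True by (intro level_less) auto
    have "i * w + level (r - l) \<le> \<alpha>2 div b" if "i < r" for i
    proof -
      have "i * w + level (r - l) \<le> (i + 1) * w" using j by simp
      also have "\<dots> \<le> r * w" using that by (intro mult_right_mono) auto
      also have "\<dots> \<le> \<alpha>2 div b" unfolding r_def by (simp add: div_mult2_eq)
      finally show ?thesis .
    qed
    then show ?thesis using True unfolding table_row_def Let_def l_def[symmetric] r_def[symmetric] by simp
  next
    case False
    then show ?thesis using assms(3) unfolding table_row_def Let_def l_def[symmetric] r_def[symmetric]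
      by (simp add: div_le_mono)
  qed
qed

lemma left_part_bounds:
  assumes "1 \<le> L" "\<alpha>1 \<le> \<alpha>2"
  shows "\<alpha>1 \<le> left_part L \<alpha>1 \<alpha>2" "left_part L \<alpha>1 \<alpha>2 \<le> \<alpha>2" "left_part L \<alpha>1 \<alpha>2 < \<alpha>1 div L * L + L"
  using assms div_mult_mod_eq[of \<alpha>1 L] mod_less_divisor[of L \<alpha>1] unfolding left_part_def by linarith+

lemma right_part_bounds:
  assumes "1 \<le> L" "\<alpha>1 \<le> \<alpha>2"
  shows "\<alpha>1 \<le> right_part L \<alpha>1 \<alpha>2" "right_part L \<alpha>1 \<alpha>2 \<le> \<alpha>2" "\<alpha>2 div L * L \<le> right_part L \<alpha>1 \<alpha>2"
    "\<alpha>2 < \<alpha>2 div L * L + L"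
  using assms div_mult_mod_eq[of \<alpha>2 L] mod_less_divisor[of L \<alpha>2] unfolding right_part_def by linarith+

text \<open>Ensures that all addresses read lie on the disk: the maxima involved are columns up to
  \<alpha>2, and table rows are bounded by \<open>table_row_le\<close>.\<close>

lemma rows_le:
  assumes "1 \<le> b" "1 \<le> w" "\<alpha>1 \<le> \<alpha>2" "\<alpha>2 < 2 ^ w" "i < 8"
    and R: "R1 = rmax h \<alpha>1 (left_part (b * w) \<alpha>1 \<alpha>2)" "R2 = rmax h (right_part (b * w) \<alpha>1 \<alpha>2) \<alpha>2"
  shows "rows b w \<alpha>1 \<alpha>2 R1 R2 ! i \<le> \<alpha>2 div b"
proof -
  have L: "1 \<le> b * w" using assms(1,2) by simp
  note lp = left_part_bounds[OF L assms(3)] and rp = right_part_bounds[OF L assms(3)]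
  have "row_end b R1 \<in> R1" "row_end b R2 \<in> R2"
    unfolding R using row_end_in[OF _ assms(1)] firsts_subset lp rp by blast+
  moreover have "row_rest b R1 \<in> R1" "row_rest b R2 \<in> R2"
    unfolding R using row_rest_in[OF _ assms(1)] lp rp by blast+
  moreover have "R1 \<subseteq> {..\<alpha>2}" "R2 \<subseteq> {..\<alpha>2}"
    unfolding R using rmax_subset lp rp by fastforce+
  ultimately have "x \<le> \<alpha>2 div b" if "x \<in> set (rows b w \<alpha>1 \<alpha>2 R1 R2)" for x
    using that assms(3) table_row_le[OF assms(1-4)]
    by (auto simp: rows_def intro!: div_le_mono)
  moreover have "i < length (rows b w \<alpha>1 \<alpha>2 R1 R2)" using assms(5) by (simp add: rows_def)
  ultimately show ?thesis using nth_mem by blast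
qed

text \<open>By \<open>firsts_subinterval\<close>, a selected column is also selected in any part of
  the query containing it. The two end parts are handled by \<open>firsts_cover\<close>, the chunks
  between them by the table.\<close>

lemma rows_cover:
  assumes b: "1 \<le> b" and w: "1 \<le> w" and le: "\<alpha>1 \<le> \<alpha>2" and lt: "\<alpha>2 < 2 ^ w"
    and R: "R1 = rmax h \<alpha>1 (left_part (b * w) \<alpha>1 \<alpha>2)" "R2 = rmax h (right_part (b * w) \<alpha>1 \<alpha>2) \<alpha>2"
  shows "firsts b (rmax h \<alpha>1 \<alpha>2) \<subseteq> (\<Union>i<8. \<Union>p<4. row_columns b w h (rows b w \<alpha>1 \<alpha>2 R1 R2 ! i) p)"
proof
  fix x assume x: "x \<in> firsts b (rmax h \<alpha>1 \<alpha>2)"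
  let ?L = "b * w" and ?rows = "rows b w \<alpha>1 \<alpha>2 R1 R2"
  let ?goal = "x \<in> (\<Union>i<8. \<Union>p<4. row_columns b w h (?rows ! i) p)"
  have L: "1 \<le> ?L" using b w by simp
  note lp = left_part_bounds[OF L le] and rp = right_part_bounds[OF L le]
  have x12: "\<alpha>1 \<le> x" "x \<le> \<alpha>2" using x firsts_subset rmax_subset by fastforce+
  have I: ?goal if "x \<in> row_columns b w h (?rows ! i) p" "i < 8" "p < 4" for i p
    using that by blast
  consider "x \<le> left_part ?L \<alpha>1 \<alpha>2" | "right_part ?L \<alpha>1 \<alpha>2 \<le> x"
    | "left_part ?L \<alpha>1 \<alpha>2 < x" "x < right_part ?L \<alpha>1 \<alpha>2" by linarith
  then show ?goal
  proof cases
    case 1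
    then have "x \<in> firsts b R1" unfolding R using x x12 lp by (intro firsts_subinterval[OF x]) auto
    then have "x \<in> row_columns b w h (?rows ! 1) 0 \<union> snapshot b h (?rows ! 2)"
      using firsts_cover[OF lp(1) b, of h] unfolding R by (auto simp: rows_def row_columns_def)
    then show ?thesis using I[of 1 0] I[of 2 1] I[of 2 2] by (auto simp: snapshot_columns[of b h _ w])
  next
    case 2
    then have "x \<in> firsts b R2" unfolding R using x x12 rp by (intro firsts_subinterval[OF x]) auto
    then have "x \<in> row_columns b w h (?rows ! 4) 0 \<union> snapshot b h (?rows ! 5)"
      using firsts_cover[OF rp(2) b, of h] unfolding R by (auto simp: rows_def row_columns_def)
    then show ?thesis using I[of 4 0] I[of 5 1] I[of 5 2] by (auto simp: snapshot_columns[of b h _ w])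
  next
    case 3
    \<comment> \<open>The middle consists of the chunks from \<open>l\<close> up to
      \<open>r - 1\<close>. Two ranges of \<open>2 ^ j\<close> chunks, one starting at
      \<open>l\<close> and one ending at \<open>r - 1\<close>, cover it since
      \<open>r - l < 2 * 2 ^ j\<close>.\<close>
    define l where "l = \<alpha>1 div ?L + 1"
    define r where "r = \<alpha>2 div ?L"
    define j where "j = level (r - l)"
    have xl: "l * ?L \<le> x" and xr: "x < r * ?L"
      using 3 x12 L unfolding l_def r_def left_part_def right_part_def by auto
    then have lr: "l < r" by (metis le_less_trans mult_less_cancel2)
    have j: "2 ^ j \<le> r - l" "r - l < 2 * 2 ^ j" unfolding j_def using lr by (auto intro!: level)
    have "r - l < 2 ^ w" using lt unfolding r_def
      by (meson diff_le_self div_le_dividend le_less_trans)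
    then have jw: "j < w" unfolding j_def using lr by (intro level_less) auto
    have a1: "\<alpha>1 \<le> l * ?L" unfolding l_def
      using div_mult_mod_eq[of \<alpha>1 ?L] mod_less_divisor[of ?L \<alpha>1] L unfolding distrib_right by linarith
    have a2: "r * ?L \<le> \<alpha>2" unfolding r_def by simp
    have in_table: "x \<in> row_columns b w h (i * w + j) 3"
      if i: "l \<le> i" "i + 2 ^ j \<le> r" "i * ?L \<le> x" "x < (i + 2 ^ j) * ?L" for i
    proof -
      have "\<alpha>1 \<le> i * ?L" using a1 mult_right_mono[OF i(1), of ?L] by linarith
      moreover have "(i + 2 ^ j) * ?L - 1 \<le> \<alpha>2" using a2 mult_right_mono[OF i(2), of ?L] by linarith
      ultimately have "x \<in> firsts b (rmax h (i * ?L) ((i + 2 ^ j) * ?L - 1))"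
        using i(3,4) by (intro firsts_subinterval[OF x]) auto
      moreover have "(i * w + j) div w = i" "(i * w + j) mod w = j" using jw by auto
      ultimately show ?thesis by (simp add: row_columns_def)
    qed
    show ?thesis
    proof (cases "x < (l + 2 ^ j) * ?L")
      case True
      have "x \<in> row_columns b w h (l * w + j) 3" using True xl j lr by (intro in_table) auto
      moreover have "?rows ! 6 = l * w + j"
        using lr unfolding rows_def table_row_def Let_def l_def[symmetric] r_def[symmetric] j_def[symmetric]
        by simp
      ultimately show ?thesis using I[of 6 3] by simp
    next
      case False
      have "r - 2 ^ j \<le> l + 2 ^ j" using j by auto
      then have "(r - 2 ^ j) * ?L \<le> x" using mult_right_mono[of "r - 2 ^ j" "l + 2 ^ j" ?L] False by linarith
      then have "x \<in> row_columns b w h ((r - 2 ^ j) * w + j) 3"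
        using xr j lr by (intro in_table) simp_all
      moreover have "?rows ! 7 = (r - 2 ^ j) * w + j"
        using lr unfolding rows_def table_row_def Let_def l_def[symmetric] r_def[symmetric] j_def[symmetric]
        by simp
      ultimately show ?thesis using I[of 7 3] by simp
    qed
  qed
qed

text \<open>One full round: it removes exactly \<open>b\<close> columns from the answer, which pays
  for it, and leaves those to the right of the last one.\<close>

lemma card_firsts_step:
  assumes "finite A" "card (firsts b A) = b" "1 \<le> b"
  shows "card A = b + card {x \<in> A. Max (firsts b A) < x}"
    "A = firsts b A \<union> {x \<in> A. Max (firsts b A) < x}"
proof -
  let ?F = "firsts b A" and ?S = "{x \<in> A. Max (firsts b A) < x}"
  have fin: "finite ?F" using assms(1) by (rule finite_firsts)
  have ne: "?F \<noteq> {}" using assms(2,3) by auto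
  have m: "Max ?F \<in> ?F" using Max_in[OF fin ne] .
  show eq: "A = ?F \<union> ?S"
    using firsts_downward[OF assms(1) m] firsts_subset[of b A] by (auto simp flip: not_le)
  have "?F \<inter> ?S = {}" using Max_ge[OF fin] by fastforce
  then have "card (?F \<union> ?S) = card ?F + card ?S" using fin assms(1) by (intro card_Un_disjoint) auto
  with eq assms(2) show "card A = b + card ?S" by simp
qed

section \<open>The query program\<close>

text \<open>
  There is no spare word to mark a missing point, so cells are filled up with the column \<open>x0\<close> of a
  point of the input: reading more points than needed is harmless.
\<close>

definition pad :: "nat \<Rightarrow> nat \<Rightarrow> nat set \<Rightarrow> nat list" where
  "pad x0 b A = sorted_list_of_set A @ replicate (b - card A) x0"

lemma length_pad: "card A \<le> b \<Longrightarrow> length (pad x0 b A) = b"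
  by (simp add: pad_def)

lemma set_pad: "finite A \<Longrightarrow> A \<subseteq> set (pad x0 b A)" "finite A \<Longrightarrow> set (pad x0 b A) \<subseteq> insert x0 A"
  by (auto simp: pad_def)

definition padded_columns :: "nat \<Rightarrow> nat \<Rightarrow> nat \<Rightarrow> (nat \<Rightarrow> nat) \<Rightarrow> nat \<Rightarrow> nat \<Rightarrow> nat list" where
  "padded_columns b w x0 h r p = pad x0 b {x \<in> row_columns b w h r p. 0 < h x}"

lemma length_padded_columns: "length (padded_columns b w x0 h r p) = b"
  unfolding padded_columns_def
  by (intro length_pad order_trans[OF card_mono card_row_columns[of b w h r p]]) (auto simp: finite_row_columns)

lemma set_padded_columns:
  "{x \<in> row_columns b w h r p. 0 < h x} \<subseteq> set (padded_columns b w x0 h r p)"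
  "set (padded_columns b w x0 h r p) \<subseteq> insert x0 {x. 0 < h x}"
  using set_pad[of "{x \<in> row_columns b w h r p. 0 < h x}" x0 b] finite_row_columns
  unfolding padded_columns_def by auto

text \<open>
  A row occupies ten blocks, of which only the first \<open>b\<close> words are used. Cells 0 to 7 hold four groups of points
  (x- and y-coordinates in separate cells, so that \<open>b = 1\<close> is possible), and cells 8 and 9 the shape of
  the chunk of the row.
\<close>

definition cell :: "nat \<Rightarrow> nat \<Rightarrow> nat \<Rightarrow> (nat \<Rightarrow> nat) \<Rightarrow> nat \<Rightarrow> nat list" where
  "cell b w x0 h a = (let r = a div 10; p = a mod 10 in
     if p < 8 then
       (if even p then padded_columns b w x0 h r (p div 2)
        else map (\<lambda>x. h x - 1) (padded_columns b w x0 h r (p div 2)))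
     else
       (let code = shape_code b w h (r div w * (b * w)) in if p = 8 then take b code else drop b code))"

text \<open>The height may equal \<open>2 ^ w\<close> because of the shift by one; what is stored is
  \<open>h x - 1\<close>.\<close>

lemma words_cell:
  assumes "h x0 > 0" "\<And>x. 0 < h x \<Longrightarrow> x < 2 ^ w \<and> h x \<le> 2 ^ w"
  shows "words w b (cell b w x0 h a)"
proof -
  have pos: "0 < h x" if "x \<in> set (padded_columns b w x0 h r p)" for x r p
    using that set_padded_columns(2) assms(1) by blast
  have code: "words w (2 * b) (shape_code b w h s)" for s by (rule words_shape_code)
  have "words w b (padded_columns b w x0 h r p)" for r p
    using pos assms(2) by (auto simp: words_def length_padded_columns)
  moreover have "words w b (map (\<lambda>x. h x - 1) (padded_columns b w x0 h r p))" for r p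
  proof -
    have "h x - 1 < 2 ^ w" if "x \<in> set (padded_columns b w x0 h r p)" for x
      using pos[OF that] assms(2)[of x] by linarith
    then show ?thesis by (auto simp: words_def length_padded_columns)
  qed
  moreover have "words w b (take b (shape_code b w h s))" "words w b (drop b (shape_code b w h s))" for s
    using code[of s] by (auto simp: words_def dest: in_set_takeD in_set_dropD)
  ultimately show ?thesis by (simp add: cell_def Let_def)
qed

lemma length_cell: "length (cell b w x0 h a) = b"
  using words_shape_code[of w b h] by (simp add: cell_def Let_def length_padded_columns words_def)

section \<open>Interpreting the memory\<close>

definition slot :: "nat \<Rightarrow> nat list \<Rightarrow> nat \<Rightarrow> nat list" where
  "slot b body t = take b (drop (t * b) body)"

text \<open>Slot \<open>10 * i + c\<close> is meant for cell \<open>c\<close> of the row with index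
  \<open>i\<close>; the slots with \<open>c\<close> equal to 8 or 9 contain shapes and are
  skipped.\<close>

definition slot_points :: "nat \<Rightarrow> nat list \<Rightarrow> point set" where
  "slot_points b body =
     (\<Union>i<8. \<Union>p<4. set (zip (slot b body (10 * i + 2 * p)) (slot b body (10 * i + 2 * p + 1))))"

text \<open>Slots 8 and 9 hold the shape of the chunk of \<alpha>1, slots 38 and 39 that of
  \<alpha>2. Until these are filled the entries computed from them are meaningless, but they are not
  consulted before.\<close>

definition decoded_rows :: "nat \<Rightarrow> nat \<Rightarrow> nat \<Rightarrow> nat \<Rightarrow> nat list \<Rightarrow> nat list" where
  "decoded_rows b w \<alpha>1 \<alpha>2 body = (let L = b * w in rows b w \<alpha>1 \<alpha>2
     (rmax (some_of_code b w (\<alpha>1 div L * L) (slot b body 8 @ slot b body 9)) \<alpha>1 (left_part L \<alpha>1 \<alpha>2))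
     (rmax (some_of_code b w (\<alpha>2 div L * L) (slot b body 38 @ slot b body 39)) (right_part L \<alpha>1 \<alpha>2) \<alpha>2))"

text \<open>The phase is stored in unary, as words may have a single bit.\<close>

definition header :: "nat \<Rightarrow> nat \<Rightarrow> nat \<Rightarrow> nat \<Rightarrow> nat list" where
  "header \<alpha>1 \<alpha>2 \<beta> s = [\<alpha>1, \<alpha>2, \<beta>] @ replicate s 1 @ replicate (82 - s) 0"

text \<open>A header has 85 words, namely three for the query and 82 for the unary phase.\<close>

definition phase :: "nat list \<Rightarrow> nat" where
  "phase m = length (takeWhile (\<lambda>x. x = 1) (take 82 (drop 3 m)))"

definition first_columns :: "nat \<Rightarrow> nat \<Rightarrow> nat \<Rightarrow> nat \<Rightarrow> (nat \<Rightarrow> nat) \<Rightarrow> nat list" where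
  "first_columns b \<alpha>1 \<alpha>2 \<beta> h = sorted_list_of_set (firsts b {x \<in> rmax h \<alpha>1 \<alpha>2. \<beta> < h x})"

definition flat_points :: "(nat \<Rightarrow> nat) \<Rightarrow> nat list \<Rightarrow> nat list" where
  "flat_points h xs = concat (map (\<lambda>x. [x, h x - 1]) xs)"

lemma length_flat_points: "length (flat_points h xs) = 2 * length xs"
  by (induction xs) (auto simp: flat_points_def)

lemma flat_points_append: "flat_points h (xs @ ys) = flat_points h xs @ flat_points h ys"
  by (simp add: flat_points_def)

text \<open>
  Phases 0 to 79 read eight rows, 80 and 81 report one half of the output words each, and 82 halts.
  The block read in phase \<open>s\<close> overwrites the unused part of the block read before. Phase 81 leaves the
  output words in place and recomputes them from the cells.
\<close>

definition query_program :: "nat \<Rightarrow> nat \<Rightarrow> nat \<Rightarrow> program" where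
  "query_program M b w m = (let \<alpha>1 = m ! 0; \<alpha>2 = m ! 1; \<beta> = m ! 2; s = phase m; body = drop 85 m in
     if s = 82 \<or> \<alpha>2 < \<alpha>1 then (m, Halt)
     else if s < 80 then
       (header \<alpha>1 \<alpha>2 \<beta> (Suc s) @ body,
        Read (10 * decoded_rows b w \<alpha>1 \<alpha>2 body ! (s div 10) + s mod 10) (85 + s * b))
     else let h = column (slot_points b body); xs = first_columns b \<alpha>1 \<alpha>2 \<beta> h; k = length xs in
       if s = 80 then
         (header \<alpha>1 \<alpha>2 \<beta> 81 @ take (80 * b) body @ flat_points h xs @ replicate (M - 85 - 80 * b - 2 * k) 0,
          Report (85 + 80 * b) k)
       else if k < b \<or> \<alpha>2 \<le> last xs then (header \<alpha>1 \<alpha>2 \<beta> 82 @ body, Report (85 + 80 * b + k) k)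
       else (header (Suc (last xs)) \<alpha>2 \<beta> 0 @ body, Report (85 + 80 * b + k) k))"

lemma length_header: "s \<le> 82 \<Longrightarrow> length (header \<alpha>1 \<alpha>2 \<beta> s) = 85"
  by (simp add: header_def)

lemma phase_header: "s \<le> 82 \<Longrightarrow> phase (header \<alpha>1 \<alpha>2 \<beta> s @ body) = s"
  by (simp add: phase_def header_def takeWhile_append)

lemma words_header:
  assumes "s \<le> 82" "1 \<le> w" "\<alpha>1 < 2 ^ w" "\<alpha>2 < 2 ^ w" "\<beta> < 2 ^ w" "words w l body"
  shows "words w (85 + l) (header \<alpha>1 \<alpha>2 \<beta> s @ body)"
proof -
  have "(1 :: nat) < 2 ^ w" using assms(2) by (intro one_less_power) auto
  then show ?thesis using assms by (auto simp: words_def header_def)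
qed

lemma query_program_header:
  assumes "s \<le> 82"
  shows "query_program M b w (header \<alpha>1 \<alpha>2 \<beta> s @ body) =
    (if s = 82 \<or> \<alpha>2 < \<alpha>1 then (header \<alpha>1 \<alpha>2 \<beta> s @ body, Halt)
     else if s < 80 then
       (header \<alpha>1 \<alpha>2 \<beta> (Suc s) @ body,
        Read (10 * decoded_rows b w \<alpha>1 \<alpha>2 body ! (s div 10) + s mod 10) (85 + s * b))
     else let h = column (slot_points b body); xs = first_columns b \<alpha>1 \<alpha>2 \<beta> h; k = length xs in
       if s = 80 then
         (header \<alpha>1 \<alpha>2 \<beta> 81 @ take (80 * b) body @ flat_points h xs @ replicate (M - 85 - 80 * b - 2 * k) 0,
          Report (85 + 80 * b) k)
       else if k < b \<or> \<alpha>2 \<le> last xs then (header \<alpha>1 \<alpha>2 \<beta> 82 @ body, Report (85 + 80 * b + k) k)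
       else (header (Suc (last xs)) \<alpha>2 \<beta> 0 @ body, Report (85 + 80 * b + k) k))"
proof -
  have nth: "(header \<alpha>1 \<alpha>2 \<beta> s @ body) ! 0 = \<alpha>1" "(header \<alpha>1 \<alpha>2 \<beta> s @ body) ! 1 = \<alpha>2"
    "(header \<alpha>1 \<alpha>2 \<beta> s @ body) ! 2 = \<beta>" by (simp_all add: header_def)
  have body: "drop 85 (header \<alpha>1 \<alpha>2 \<beta> s @ body) = body" using length_header[OF assms] by simp
  show ?thesis unfolding query_program_def Let_def phase_header[OF assms] nth body ..
qed

lemma store_header:
  assumes "s \<le> 82"
  shows "store (85 + p) blk (header \<alpha>1 \<alpha>2 \<beta> s @ body) =
    header \<alpha>1 \<alpha>2 \<beta> s @ take p body @ blk @ drop (p + length blk) body"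
  using length_header[OF assms, of \<alpha>1 \<alpha>2 \<beta>] by (simp add: store_def)

lemma drop_header:
  "s \<le> 82 \<Longrightarrow> drop (85 + p) (header \<alpha>1 \<alpha>2 \<beta> s @ body) = drop p body"
  using length_header[of s \<alpha>1 \<alpha>2 \<beta>] by simp

text \<open>Slots below \<open>s\<close> lie within the first \<open>s * b\<close> words, so neither
  later reads nor the output area behind all slots disturb them.\<close>

lemma slot_unchanged:
  assumes "t < s" "s * b \<le> length body"
  shows "slot b (take (s * b) body @ rest) t = slot b body t"
proof -
  have "(t + 1) * b \<le> s * b" using assms(1) by (intro mult_right_mono) auto
  then have le: "t * b + b \<le> s * b" by simp
  have len: "length (take (s * b) body) = s * b" using assms(2) by simp
  have "slot b (take (s * b) body @ rest) t = take b (drop (t * b) (take (s * b) body))"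
    using le unfolding slot_def drop_append take_append length_drop len by simp
  also have "\<dots> = slot b body t" using le by (simp add: slot_def drop_take min_absorb1)
  finally show ?thesis .
qed

lemma slot_stored:
  assumes "s * b \<le> length body" "length c = b"
  shows "slot b (take (s * b) body @ (c @ c') @ rest) s = c"
  using assms by (simp add: slot_def)

lemma set_zip_map: "set (zip xs (map f xs)) = (\<lambda>x. (x, f x)) ` set xs"
  by (induction xs) auto

section \<open>Correctness and cost of the query program\<close>

locale query_machine =
  fixes M B w b :: nat and U :: nat and P :: "point set" and x0 :: nat and D :: "nat list list"
  \<comment> \<open>The memory must hold 85 header words, 80 slots and \<open>2 * b\<close> output
    words; the summand \<open>B\<close> leaves room for a whole disk block read into the last
    slot.\<close>
  assumes params: "1 \<le> b" "1 \<le> w" "b \<le> B" "85 + 82 * b + B \<le> M" "U \<le> 2 ^ w"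
    and P_sub: "P \<subseteq> {..<U} \<times> {..<U}" and inj: "inj_on fst P"
    and x0: "0 < column P x0"
    and D_def: "D = map (\<lambda>a. cell b w x0 (column P) a @ replicate (B - b) 0) [0..<10 * ((U + b - 1) div b)]"
begin

abbreviation "h \<equiv> column P"
abbreviation "f \<equiv> query_program M b w"

definition "true_rows \<alpha>1 \<alpha>2 = rows b w \<alpha>1 \<alpha>2
  (rmax h \<alpha>1 (left_part (b * w) \<alpha>1 \<alpha>2)) (rmax h (right_part (b * w) \<alpha>1 \<alpha>2) \<alpha>2)"

text \<open>The invariant of the reading phases. It refers to the rows determined by the true
  heights, which the program knows only through the decoded shapes.\<close>

definition "loaded \<alpha>1 \<alpha>2 s body \<longleftrightarrow>
  (\<forall>t<s. slot b body t = cell b w x0 h (10 * true_rows \<alpha>1 \<alpha>2 ! (t div 10) + t mod 10))"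

lemma column_bound: "0 < h x \<Longrightarrow> x < U \<and> h x \<le> U"
  using top_point_in[OF inj, of x] P_sub by (force simp: top_point_def)

lemma words_cells: "words w b (cell b w x0 h a)"
  using column_bound params(5) by (intro words_cell x0) (meson less_le_trans order_trans)

lemma is_disk: "is_disk B w D"
  using words_cells params(3) by (fastforce simp: is_disk_def D_def words_def)

lemma disk_nth:
  assumes "\<alpha>2 < U" "r \<le> \<alpha>2 div b" "p < 10"
  shows "10 * r + p < length D" "D ! (10 * r + p) = cell b w x0 h (10 * r + p) @ replicate (B - b) 0"
proof -
  have "\<alpha>2 div b + 1 = (\<alpha>2 + b) div b" using params(1) by simp
  also have "\<dots> \<le> (U + b - 1) div b" using assms(1) by (intro div_le_mono) simp
  finally have "r + 1 \<le> (U + b - 1) div b" using assms(2) by simp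
  then show "10 * r + p < length D" using assms(3) unfolding D_def by simp
  then show "D ! (10 * r + p) = cell b w x0 h (10 * r + p) @ replicate (B - b) 0"
    unfolding D_def by simp
qed

lemma true_rows_le:
  assumes "\<alpha>1 \<le> \<alpha>2" "\<alpha>2 < U" "i < 8"
  shows "true_rows \<alpha>1 \<alpha>2 ! i \<le> \<alpha>2 div b"
  unfolding true_rows_def using params assms by (intro rows_le) auto

text \<open>Rows 1 and 2 depend on the shape in cells 8 and 9 of row 0, rows 4 and 5 on that in row 3.\<close>

lemma shape_slots:
  assumes "loaded \<alpha>1 \<alpha>2 s body" "10 * i + 9 < s" "true_rows \<alpha>1 \<alpha>2 ! i = \<alpha> div b"
  shows "slot b body (10 * i + 8) @ slot b body (10 * i + 9) = shape_code b w h (\<alpha> div (b * w) * (b * w))"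
proof -
  have "slot b body (10 * i + 8) = cell b w x0 h (10 * (\<alpha> div b) + 8)"
    "slot b body (10 * i + 9) = cell b w x0 h (10 * (\<alpha> div b) + 9)"
    using assms by (simp_all add: loaded_def)
  then show ?thesis by (simp add: cell_def Let_def div_mult2_eq)
qed

text \<open>Shapes arrive in time: slots 8 and 9 are filled before row 1 is requested, slots 38 and
  39 before row 4. The remaining rows depend on the query alone.\<close>

lemma decoded_rows_correct:
  assumes l: "loaded \<alpha>1 \<alpha>2 s body" and i: "i < 8" "10 * i \<le> s" and le: "\<alpha>1 \<le> \<alpha>2"
  shows "decoded_rows b w \<alpha>1 \<alpha>2 body ! i = true_rows \<alpha>1 \<alpha>2 ! i"
proof -
  let ?L = "b * w"
  have L: "1 \<le> ?L" using params by simp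
  note lp = left_part_bounds[OF L le] and rp = right_part_bounds[OF L le]
  have left: "rmax (some_of_code b w (\<alpha>1 div ?L * ?L) (slot b body 8 @ slot b body 9)) \<alpha>1 (left_part ?L \<alpha>1 \<alpha>2)
      = rmax h \<alpha>1 (left_part ?L \<alpha>1 \<alpha>2)" if "10 \<le> s"
  proof -
    have "slot b body 8 @ slot b body 9 = shape_code b w h (\<alpha>1 div ?L * ?L)"
      using shape_slots[OF l, of 0 \<alpha>1] that by (simp add: true_rows_def rows_def)
    then show ?thesis using rmax_some_of_code[of "\<alpha>1 div ?L * ?L" \<alpha>1 _ b w h] lp by simp
  qed
  have right: "rmax (some_of_code b w (\<alpha>2 div ?L * ?L) (slot b body 38 @ slot b body 39)) (right_part ?L \<alpha>1 \<alpha>2) \<alpha>2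
      = rmax h (right_part ?L \<alpha>1 \<alpha>2) \<alpha>2" if "40 \<le> s"
  proof -
    have "slot b body 38 @ slot b body 39 = shape_code b w h (\<alpha>2 div ?L * ?L)"
      using shape_slots[OF l, of 3 \<alpha>2] that by (simp add: true_rows_def rows_def)
    then show ?thesis using rmax_some_of_code[of "\<alpha>2 div ?L * ?L" "right_part ?L \<alpha>1 \<alpha>2" \<alpha>2 b w h] rp by simp
  qed
  have "i = 0 \<or> i = 1 \<or> i = 2 \<or> i = 3 \<or> i = 4 \<or> i = 5 \<or> i = 6 \<or> i = 7" using i by arith
  then show ?thesis using left right i
    by (elim disjE) (simp_all add: decoded_rows_def true_rows_def rows_def Let_def)
qed

definition "loaded_columns \<alpha>1 \<alpha>2 =
  (\<Union>i<8. \<Union>p<4. set (padded_columns b w x0 h (true_rows \<alpha>1 \<alpha>2 ! i) p))"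

lemma slot_points_loaded:
  assumes "loaded \<alpha>1 \<alpha>2 80 body"
  shows "slot_points b body = top_point h ` loaded_columns \<alpha>1 \<alpha>2"
proof -
  have "set (zip (slot b body (10 * i + 2 * p)) (slot b body (10 * i + 2 * p + 1))) =
      top_point h ` set (padded_columns b w x0 h (true_rows \<alpha>1 \<alpha>2 ! i) p)" if "i < 8" "p < 4" for i p
  proof -
    have idx: "10 * i + 2 * p + 1 < 80" "(10 * i + 2 * p) div 10 = i" "(10 * i + 2 * p + 1) div 10 = i"
      "(10 * i + 2 * p) mod 10 = 2 * p" "(10 * i + 2 * p + 1) mod 10 = 2 * p + 1"
      using that by auto
    let ?r = "true_rows \<alpha>1 \<alpha>2 ! i"
    have m: "(10 * ?r + 2 * p) div 10 = ?r" "(10 * ?r + (2 * p + 1)) div 10 = ?r"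
      "(10 * ?r + 2 * p) mod 10 = 2 * p" "(10 * ?r + (2 * p + 1)) mod 10 = 2 * p + 1"
      using that by auto
    have "slot b body (10 * i + 2 * p) = cell b w x0 h (10 * ?r + 2 * p)"
      using assms idx unfolding loaded_def by (metis add_lessD1)
    also have "\<dots> = padded_columns b w x0 h ?r p"
      unfolding cell_def Let_def m using that by simp
    finally have 1: "slot b body (10 * i + 2 * p) = padded_columns b w x0 h ?r p" .
    have "slot b body (10 * i + 2 * p + 1) = cell b w x0 h (10 * ?r + (2 * p + 1))"
      using assms idx unfolding loaded_def by metis
    also have "\<dots> = map (\<lambda>x. h x - 1) (padded_columns b w x0 h ?r p)"
      unfolding cell_def Let_def m using that by simp
    finally show ?thesis using 1 by (simp add: set_zip_map top_point_def[abs_def])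
  qed
  then show ?thesis unfolding slot_points_def loaded_columns_def by (simp add: image_UN)
qed

lemma column_loaded:
  assumes "loaded \<alpha>1 \<alpha>2 80 body"
  shows "column (slot_points b body) = (\<lambda>x. if x \<in> loaded_columns \<alpha>1 \<alpha>2 then h x else 0)"
  unfolding slot_points_loaded[OF assms]
proof (rule column_top_points)
  fix x assume "x \<in> loaded_columns \<alpha>1 \<alpha>2"
  then show "0 < h x" using set_padded_columns(2)[of b w x0 h] x0 unfolding loaded_columns_def by blast
qed

text \<open>Storing only nonempty columns loses nothing here, since an answer above \<beta> has
  positive height.\<close>

lemma loaded_cover:
  assumes "\<alpha>1 \<le> \<alpha>2" "\<alpha>2 < U"
  shows "firsts b {x \<in> rmax h \<alpha>1 \<alpha>2. \<beta> < h x} \<subseteq> loaded_columns \<alpha>1 \<alpha>2"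
proof
  fix x assume x: "x \<in> firsts b {x \<in> rmax h \<alpha>1 \<alpha>2. \<beta> < h x}"
  then have "x \<in> {x \<in> rmax h \<alpha>1 \<alpha>2. \<beta> < h x}" using firsts_subset by (rule rev_subsetD)
  then have "0 < h x" by simp
  have "x \<in> firsts b (rmax h \<alpha>1 \<alpha>2)" using firsts_threshold x by (rule subsetD)
  with rows_cover[OF params(1,2) assms(1) less_le_trans[OF assms(2) params(5)] refl refl, of h]
  have "x \<in> (\<Union>i<8. \<Union>p<4. row_columns b w h (true_rows \<alpha>1 \<alpha>2 ! i) p)"
    unfolding true_rows_def by (rule subsetD)
  then obtain i p where ip: "i < 8" "p < 4" "x \<in> row_columns b w h (true_rows \<alpha>1 \<alpha>2 ! i) p" by blast
  then have "x \<in> set (padded_columns b w x0 h (true_rows \<alpha>1 \<alpha>2 ! i) p)"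
    using \<open>0 < h x\<close> by (intro subsetD[OF set_padded_columns(1)]) simp
  with ip(1,2) show "x \<in> loaded_columns \<alpha>1 \<alpha>2" unfolding loaded_columns_def by blast
qed

text \<open>By \<open>firsts_partial\<close> and \<open>loaded_cover\<close>, knowing only the
  points read does not alter the selection.\<close>

lemma computed_answer:
  fixes \<beta> :: nat
  assumes "loaded \<alpha>1 \<alpha>2 80 body" "\<alpha>1 \<le> \<alpha>2" "\<alpha>2 < U"
  defines "xs \<equiv> first_columns b \<alpha>1 \<alpha>2 \<beta> h"
  shows "first_columns b \<alpha>1 \<alpha>2 \<beta> (column (slot_points b body)) = xs"
    "flat_points (column (slot_points b body)) xs = flat_points h xs"
proof -
  note cov = loaded_cover[OF assms(2,3), of \<beta>]
  show "first_columns b \<alpha>1 \<alpha>2 \<beta> (column (slot_points b body)) = xs"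
    unfolding xs_def first_columns_def column_loaded[OF assms(1)] firsts_partial[OF cov] ..
  have "set xs \<subseteq> loaded_columns \<alpha>1 \<alpha>2"
    unfolding xs_def first_columns_def using cov by (simp add: finite_firsts)
  then show "flat_points (column (slot_points b body)) xs = flat_points h xs"
    unfolding flat_points_def column_loaded[OF assms(1)]
    by (intro arg_cong[where f = concat] map_cong) auto
qed

text \<open>Phrased as extending an arbitrary run from phase 80 backwards, because
  \<open>run\<close> derivations are built from their end; accordingly the induction on
  \<open>s\<close> descends from 80.\<close>

lemma run_load:
  assumes "s \<le> 80" "\<alpha>1 \<le> \<alpha>2" "\<alpha>2 < U" "\<beta> < U"
    and "words w (M - 85) body" "loaded \<alpha>1 \<alpha>2 s body"
  shows "\<exists>body'. words w (M - 85) body' \<and> loaded \<alpha>1 \<alpha>2 80 body' \<and>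
    (\<forall>out t. run M B w f (header \<alpha>1 \<alpha>2 \<beta> 80 @ body') D D out t \<longrightarrow>
      run M B w f (header \<alpha>1 \<alpha>2 \<beta> s @ body) D D out (80 - s + t))"
  using assms(1,5,6)
proof (induction s arbitrary: body rule: inc_induct)
  case base
  then show ?case by auto
next
  case (step s)
  let ?r = "true_rows \<alpha>1 \<alpha>2 ! (s div 10)"
  let ?a = "10 * ?r + s mod 10"
  let ?blk = "cell b w x0 h ?a @ replicate (B - b) 0"
  let ?body' = "take (s * b) body @ ?blk @ drop (s * b + B) body"
  have s8: "s div 10 < 8" "10 * (s div 10) \<le> s" using step.hyps by auto
  have row: "decoded_rows b w \<alpha>1 \<alpha>2 body ! (s div 10) = ?r"
    using decoded_rows_correct[OF step.prems(2) s8] assms(2) by simp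
  have "?r \<le> \<alpha>2 div b" using true_rows_le assms(2,3) s8 by blast
  note disk = disk_nth[OF assms(3) this, of "s mod 10", simplified]
  have sb: "s * b \<le> 79 * b" using step.hyps by (intro mult_right_mono) auto
  have len: "length ?blk = B" using length_cell params(3) by simp
  have lb: "length body = M - 85" using step.prems by (simp add: words_def)
  have sum: "s * b + B \<le> length body" using sb params lb by linarith
  have wblk: "\<forall>x\<in>set ?blk. x < 2 ^ w" using words_cells[of ?a] by (auto simp: words_def)
  have body': "words w (M - 85) ?body'"
  proof -
    have "length ?body' = s * b + B + (M - 85 - (s * b + B))"
      unfolding length_append len[unfolded length_append] using sum lb by simp
    then have "length ?body' = M - 85" using sum lb by linarith
    moreover have "set ?body' \<subseteq> set body \<union> set ?blk"
      by (auto dest: in_set_takeD in_set_dropD)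
    then have "\<forall>x\<in>set ?body'. x < 2 ^ w"
      using step.prems(1) wblk unfolding words_def by blast
    ultimately show ?thesis unfolding words_def by blast
  qed
  have "slot b ?body' t' = cell b w x0 h (10 * true_rows \<alpha>1 \<alpha>2 ! (t' div 10) + t' mod 10)" if "t' < Suc s" for t'
  proof (cases "t' = s")
    case True
    then show ?thesis using slot_stored[of s b body "cell b w x0 h ?a"] sum length_cell by simp
  next
    case False
    then show ?thesis using slot_unchanged[of t' s b body] that sum step.prems(2)
      by (simp add: loaded_def)
  qed
  then have "loaded \<alpha>1 \<alpha>2 (Suc s) ?body'" by (simp add: loaded_def)
  from step.IH[OF body' this]
  obtain body'' where body'': "words w (M - 85) body''" "loaded \<alpha>1 \<alpha>2 80 body''"
    and run'': "\<And>out t. run M B w f (header \<alpha>1 \<alpha>2 \<beta> 80 @ body'') D D out t \<Longrightarrow>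
      run M B w f (header \<alpha>1 \<alpha>2 \<beta> (Suc s) @ ?body') D D out (80 - Suc s + t)" by blast
  have f: "f (header \<alpha>1 \<alpha>2 \<beta> s @ body) = (header \<alpha>1 \<alpha>2 \<beta> (Suc s) @ body, Read ?a (85 + s * b))"
    using query_program_header[of s M b w \<alpha>1 \<alpha>2 \<beta> body] step.hyps assms(2) row by simp
  have U: "\<alpha>1 < 2 ^ w" "\<alpha>2 < 2 ^ w" "\<beta> < 2 ^ w" using assms params by simp_all
  have words: "words w M (header \<alpha>1 \<alpha>2 \<beta> (Suc s) @ body)"
    using words_header[OF _ params(2) U step.prems(1), of "Suc s"] step.hyps params by simp
  have "run M B w f (header \<alpha>1 \<alpha>2 \<beta> s @ body) D D out (80 - s + t)"
    if "run M B w f (header \<alpha>1 \<alpha>2 \<beta> 80 @ body'') D D out t" for out t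
  proof -
    have "run M B w f (header \<alpha>1 \<alpha>2 \<beta> s @ body) D D out (Suc (80 - Suc s + t))"
    proof (rule run_read[where f = f, OF f words disk(1)])
      show "85 + s * b + B \<le> M" using sb params by linarith
      show "run M B w f (store (85 + s * b) (D ! ?a) (header \<alpha>1 \<alpha>2 \<beta> (Suc s) @ body)) D D out (80 - Suc s + t)"
        using run''[OF that] step.hyps len unfolding disk(2) by (subst store_header) simp_all
    qed
    moreover have "Suc (80 - Suc s + t) = 80 - s + t" using step.hyps by arith
    ultimately show ?thesis by (simp only:)
  qed
  with body'' show ?case by blast
qed

text \<open>A round costs 80 reads and two reports of \<open>k\<close> words each, where
  \<open>k\<close> is at most \<open>b\<close> and thus fits a block. Every round after which the
  search continues outputs exactly \<open>b\<close> points. The induction is on the length of the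
  remaining range.\<close>

lemma run_query:
  assumes "\<alpha>1 \<le> \<alpha>2" "\<alpha>2 < U" "\<beta> < U" "words w (M - 85) body"
  defines "G \<equiv> {x \<in> rmax h \<alpha>1 \<alpha>2. \<beta> < h x}"
  shows "\<exists>xs t. distinct xs \<and> set xs = G \<and> t \<le> 82 * (1 + card G div b) \<and>
    run M B w f (header \<alpha>1 \<alpha>2 \<beta> 0 @ body) D D (flat_points h xs) t"
  using assms(1,4) unfolding G_def
proof (induction "\<alpha>2 - \<alpha>1" arbitrary: \<alpha>1 body rule: less_induct)
  case less
  let ?G = "{x \<in> rmax h \<alpha>1 \<alpha>2. \<beta> < h x}"
  let ?F = "firsts b ?G"
  define xs where "xs = first_columns b \<alpha>1 \<alpha>2 \<beta> h"
  define k where "k = length xs"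
  define out where "out = flat_points h xs"
  have finF: "finite ?F" by (simp add: finite_firsts)
  have xs: "set xs = ?F" "distinct xs" "sorted xs"
    using finF by (simp_all add: xs_def first_columns_def)
  have k: "k = card ?F" unfolding k_def using xs distinct_card by metis
  have kb: "k \<le> b" unfolding k by (rule card_firsts_le) simp
  have lenout: "length out = 2 * k" by (simp add: out_def k_def length_flat_points)
  have bound: "\<alpha>1 < 2 ^ w" "\<alpha>2 < 2 ^ w" "\<beta> < 2 ^ w" using assms(2,3) less.prems(1) params by simp_all
  have wout: "\<forall>x\<in>set out. x < 2 ^ w"
  proof -
    have "x < 2 ^ w \<and> h x - 1 < 2 ^ w" if "x \<in> set xs" for x
    proof -
      have "0 < h x" using that xs(1) firsts_subset by fastforce
      then show ?thesis using column_bound[of x] params(5) by linarith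
    qed
    then show ?thesis by (auto simp: out_def flat_points_def)
  qed
  \<comment> \<open>The second condition ensures that the next left end \<open>Suc (last xs)\<close>
    is at most \<alpha>2, and hence also fits into a word.\<close>
  define stop where "stop \<longleftrightarrow> k < b \<or> \<alpha>2 \<le> last xs"
  define \<alpha>' where "\<alpha>' = (if stop then \<alpha>1 else Suc (last xs))"
  define s' where "s' = (if stop then 82 else 0 :: nat)"
  have \<alpha>': "\<alpha>' < 2 ^ w" using bound unfolding \<alpha>'_def stop_def by simp
  obtain body1 where w1: "words w (M - 85) body1"
    and loop: "\<And>rest t. run M B w f (header \<alpha>' \<alpha>2 \<beta> s' @ body1) D D rest t \<Longrightarrow>
      run M B w f (header \<alpha>1 \<alpha>2 \<beta> 0 @ body) D D (out @ rest) (82 + t)"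
  proof -
    have "loaded \<alpha>1 \<alpha>2 0 body" by (simp add: loaded_def)
    from run_load[OF _ less.prems(1) assms(2,3) less.prems(2) this]
    obtain body0 where w0: "words w (M - 85) body0" and l0: "loaded \<alpha>1 \<alpha>2 80 body0"
      and run0: "\<And>out t. run M B w f (header \<alpha>1 \<alpha>2 \<beta> 80 @ body0) D D out t \<Longrightarrow>
        run M B w f (header \<alpha>1 \<alpha>2 \<beta> 0 @ body) D D out (80 + t)" by auto
    let ?pre = "take (80 * b) body0"
    define body1 where "body1 = ?pre @ out @ replicate (M - 85 - 80 * b - 2 * k) 0"
    have lpre: "length ?pre = 80 * b" using w0 params by (simp add: words_def)
    \<comment> \<open>The output is placed behind the slots, so phase 81 computes the same columns
      again.\<close>
    have l1: "loaded \<alpha>1 \<alpha>2 80 body1"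
      using l0 slot_unchanged[of _ 80 b body0] w0 params by (simp add: loaded_def words_def body1_def)
    have w1: "words w (M - 85) body1"
      using w0 wout lpre lenout kb params by (auto simp: words_def body1_def dest: in_set_takeD)
    note ans0 = computed_answer[OF l0 less.prems(1) assms(2), of \<beta>, folded xs_def]
    note ans1 = computed_answer[OF l1 less.prems(1) assms(2), of \<beta>, folded xs_def]
    have f0: "f (header \<alpha>1 \<alpha>2 \<beta> 80 @ body0) = (header \<alpha>1 \<alpha>2 \<beta> 81 @ body1, Report (85 + 80 * b) k)"
      using query_program_header[of 80 M b w \<alpha>1 \<alpha>2 \<beta> body0] less.prems(1)
      by (simp add: Let_def ans0 body1_def flip: out_def k_def)
    have f1: "f (header \<alpha>1 \<alpha>2 \<beta> 81 @ body1) = (header \<alpha>' \<alpha>2 \<beta> s' @ body1, Report (85 + 80 * b + k) k)"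
      using query_program_header[of 81 M b w \<alpha>1 \<alpha>2 \<beta> body1] less.prems(1)
      by (simp add: Let_def ans1 \<alpha>'_def s'_def stop_def flip: k_def)
    have "run M B w f (header \<alpha>1 \<alpha>2 \<beta> 0 @ body) D D (out @ rest) (82 + t)"
      if rest: "run M B w f (header \<alpha>' \<alpha>2 \<beta> s' @ body1) D D rest t" for rest t
    proof -
      have "run M B w f (header \<alpha>1 \<alpha>2 \<beta> 81 @ body1) D D
          (take k (drop (85 + 80 * b + k) (header \<alpha>' \<alpha>2 \<beta> s' @ body1)) @ rest) (Suc t)"
      proof (rule run_report[where f = f, OF f1])
        show "words w M (header \<alpha>' \<alpha>2 \<beta> s' @ body1)"
          using words_header[OF _ params(2) \<alpha>' bound(2,3) w1, of s'] params by (simp add: s'_def)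
      qed (use kb params rest in auto)
      moreover have "take k (drop (85 + 80 * b + k) (header \<alpha>' \<alpha>2 \<beta> s' @ body1)) = drop k out"
        using lpre lenout drop_header[of s' "80 * b + k" \<alpha>' \<alpha>2 \<beta> body1] by (simp add: s'_def add.assoc body1_def)
      ultimately have run1: "run M B w f (header \<alpha>1 \<alpha>2 \<beta> 81 @ body1) D D (drop k out @ rest) (Suc t)"
        by (simp only:)
      have "run M B w f (header \<alpha>1 \<alpha>2 \<beta> 80 @ body0) D D
          (take k (drop (85 + 80 * b) (header \<alpha>1 \<alpha>2 \<beta> 81 @ body1)) @ drop k out @ rest) (Suc (Suc t))"
      proof (rule run_report[where f = f, OF f0])
        show "words w M (header \<alpha>1 \<alpha>2 \<beta> 81 @ body1)"
          using words_header[OF _ params(2) bound w1, of 81] params by simp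
      qed (use kb params run1 in auto)
      moreover have "take k (drop (85 + 80 * b) (header \<alpha>1 \<alpha>2 \<beta> 81 @ body1)) = take k out"
      proof -
        have "drop (85 + 80 * b) (header \<alpha>1 \<alpha>2 \<beta> 81 @ body1) = drop (80 * b) body1"
          by (rule drop_header) simp
        also have "\<dots> = out @ replicate (M - 85 - 80 * b - 2 * k) 0" using lpre by (simp add: body1_def)
        finally show ?thesis using lenout by (simp only: take_append) simp
      qed
      ultimately have "run M B w f (header \<alpha>1 \<alpha>2 \<beta> 80 @ body0) D D (out @ rest) (2 + t)"
        by (simp only: add_2_eq_Suc append_assoc[symmetric] append_take_drop_id)
      from run0[OF this] show ?thesis by simp
    qed
    with w1 show ?thesis by (rule that)
  qed
  show ?case
  proof (cases stop)
    case True
    have halt: "run M B w f (header \<alpha>' \<alpha>2 \<beta> s' @ body') D D [] 0" for body'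
      using query_program_header[of 82 M b w \<alpha>' \<alpha>2 \<beta> body'] True
      by (intro run_halt) (simp add: s'_def)
    \<comment> \<open>Either the selection is not full or it reaches \<alpha>2; in both cases
      nothing remains.\<close>
    have "?F = ?G"
    proof (cases "k < b")
      case True then show ?thesis unfolding k by (intro firsts_eq_self) auto
    next
      case False
      then have cb: "card ?F = b" and last: "\<alpha>2 \<le> last xs" using True kb k by (auto simp: stop_def)
      have "xs \<noteq> []" using False params(1) by (auto simp: k_def)
      then have "last xs \<in> ?F" using xs(1) last_in_set by metis
      then have "\<alpha>2 \<le> Max ?F" using last finF Max_ge order_trans by blast
      then have "{x \<in> ?G. Max ?F < x} = {}" using rmax_subset[of h \<alpha>1 \<alpha>2] by fastforce
      then show ?thesis using card_firsts_step(2)[OF _ cb params(1)] by auto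
    qed
    then show ?thesis using loop[OF halt[of body1]] xs by (intro exI[of _ xs] exI[of _ 82]) (auto simp: out_def)
  next
    case False
    then have cb: "card ?F = b" and last: "last xs < \<alpha>2" using kb k by (auto simp: stop_def)
    have ne: "xs \<noteq> []" using cb k params(1) by (auto simp: k_def)
    have lastF: "last xs \<in> ?F" using xs(1) ne last_in_set by metis
    have "sorted (butlast xs @ [last xs])" using xs(3) ne by simp
    then have "\<forall>y\<in>set (butlast xs @ [last xs]). y \<le> last xs" by (auto simp: sorted_append)
    then have le_last: "\<forall>y\<in>?F. y \<le> last xs" using xs(1) ne by simp
    then have Max: "Max ?F = last xs" using finF lastF by (intro Max_eqI) auto
    have "\<alpha>1 \<le> last xs" using lastF firsts_subset rmax_subset by fastforce
    let ?G' = "{x \<in> rmax h \<alpha>' \<alpha>2. \<beta> < h x}"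
    have \<alpha>'_eq: "\<alpha>' = Suc (last xs)" "s' = 0" using False by (simp_all add: \<alpha>'_def s'_def)
    have "rmax h \<alpha>' \<alpha>2 = rmax h \<alpha>1 \<alpha>2 \<inter> {\<alpha>'..}"
      using \<open>\<alpha>1 \<le> last xs\<close> \<alpha>'_eq(1) by (intro rmax_restrict) simp
    then have rest: "rmax h \<alpha>' \<alpha>2 = rmax h \<alpha>1 \<alpha>2 \<inter> {last xs<..}"
      unfolding \<alpha>'_eq(1) atLeast_Suc_greaterThan .
    have G': "?G' = {x \<in> ?G. Max ?F < x}" unfolding rest Max by blast
    note step = card_firsts_step[OF _ cb params(1), folded G', simplified]
    have meas: "\<alpha>2 - \<alpha>' < \<alpha>2 - \<alpha>1" "\<alpha>' \<le> \<alpha>2" using last \<open>\<alpha>1 \<le> last xs\<close> unfolding \<alpha>'_eq by simp_all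
    obtain ys t where ys: "distinct ys" "set ys = ?G'" "t \<le> 82 * (1 + card ?G' div b)"
      and run: "run M B w f (header \<alpha>' \<alpha>2 \<beta> s' @ body1) D D (flat_points h ys) t"
      using less.hyps[OF meas w1] unfolding \<alpha>'_eq(2) by blast
    have "set xs \<inter> set ys = {}"
      unfolding ys(2) G' Max xs(1) using le_last by (auto simp: not_less)
    then have "distinct (xs @ ys)" using xs ys by simp
    moreover have "set (xs @ ys) = ?G" using step(2) xs ys by simp
    \<comment> \<open>The \<open>b\<close> columns removed lower \<open>card ?G div b\<close> by
      exactly one, which accounts for the 82 I/Os of this round.\<close>
    moreover have "82 + t \<le> 82 * (1 + card ?G div b)"
      using step(1) ys(3) params(1) by simp
    moreover have "run M B w f (header \<alpha>1 \<alpha>2 \<beta> 0 @ body) D D (flat_points h (xs @ ys)) (82 + t)"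
      using loop[OF run] by (simp add: flat_points_append out_def)
    ultimately show ?thesis by blast
  qed
qed

lemma answers_query:
  assumes "\<alpha>1 < U" "\<alpha>2 < U" "\<beta> < U"
  shows "\<exists>t. answers M B w f U P D \<alpha>1 \<alpha>2 \<beta> D t \<and>
    t \<le> 82 * (1 + card (range_skyline P (top_open U \<alpha>1 \<alpha>2 \<beta>)) div b)"
proof -
  let ?G = "{x \<in> rmax h \<alpha>1 \<alpha>2. \<beta> < h x}"
  let ?body = "replicate (M - 85) 0"
  have "P \<subseteq> UNIV \<times> {..U}" using P_sub by auto
  from range_skyline_columns[OF inj this]
  have sky: "range_skyline P (top_open U \<alpha>1 \<alpha>2 \<beta>) = top_point h ` ?G" .
  have card: "card (top_point h ` ?G) = card ?G"
    by (intro card_image) (simp add: inj_on_def top_point_def)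
  \<comment> \<open>The zeros behind the query already form the unary code of phase 0.\<close>
  have "M - 3 = 82 + (M - 85)" using params by simp
  then have start: "query_memory M \<alpha>1 \<alpha>2 \<beta> = header \<alpha>1 \<alpha>2 \<beta> 0 @ ?body"
    unfolding query_memory_def header_def by (simp only: replicate_add append_assoc) simp
  have "\<exists>xs t. distinct xs \<and> set xs = ?G \<and> t \<le> 82 * (1 + card ?G div b) \<and>
    run M B w f (header \<alpha>1 \<alpha>2 \<beta> 0 @ ?body) D D (flat_points h xs) t"
  proof (cases "\<alpha>1 \<le> \<alpha>2")
    case True
    then show ?thesis using assms by (intro run_query) (auto simp: words_def)
  next
    case False
    have "run M B w f (header \<alpha>1 \<alpha>2 \<beta> 0 @ ?body) D D [] 0"
      using query_program_header[of 0 M b w \<alpha>1 \<alpha>2 \<beta> ?body] False by (intro run_halt) simp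
    then show ?thesis using False by (intro exI[of _ "[]"] exI[of _ 0]) (simp add: flat_points_def rmax_def)
  qed
  then obtain xs t where xs: "distinct xs" "set xs = ?G" and t: "t \<le> 82 * (1 + card ?G div b)"
    and run: "run M B w f (query_memory M \<alpha>1 \<alpha>2 \<beta>) D D (flat_points h xs) t"
    unfolding start by blast
  have "lists_points (flat_points h xs) (top_point h ` ?G)"
    unfolding lists_points_def flat_points_def using xs
    by (intro exI[of _ "map (top_point h) xs"]) (auto simp: distinct_map inj_on_def top_point_def comp_def)
  then have "answers M B w f U P D \<alpha>1 \<alpha>2 \<beta> D t" unfolding answers_def sky using run by blast
  with t show ?thesis unfolding sky card by blast
qed

end

section \<open>Choice of the cell size and the upper bound\<close>

definition cell_size :: "nat \<Rightarrow> nat" where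
  "cell_size B = max 1 (B div 128)"

lemma cell_size:
  assumes "1 \<le> B"
  shows "1 \<le> cell_size B" "cell_size B \<le> B" "B \<le> 256 * cell_size B"
  using assms unfolding cell_size_def by auto

text \<open>If the cell size is at least 2, then 128 cells fit into \<open>B\<close> words, and the
  surplus of 46 cells over the required 82 makes room for the 85 header words. Otherwise
  \<open>B < 256\<close>, and 512 words are enough.\<close>

lemma cell_size_memory:
  assumes "2 * B \<le> M" "512 \<le> M"
  shows "85 + 82 * cell_size B + B \<le> M"
proof (cases "2 \<le> B div 128")
  case True
  then have "128 * cell_size B \<le> B" "2 \<le> cell_size B" by (auto simp: cell_size_def)
  then show ?thesis using assms(1) by linarith
next
  case False
  then have "cell_size B = 1" "B < 256" by (auto simp: cell_size_def)
  then show ?thesis using assms(2) by linarith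
qed

lemma divide_cell_size:
  assumes "1 \<le> B" shows "real k / real (cell_size B) \<le> 256 * (real k / real B)"
proof -
  have "real B \<le> 256 * real (cell_size B)" using cell_size(3)[OF assms] by linarith
  then have "real k * real B \<le> real k * (256 * real (cell_size B))" by (intro mult_left_mono) auto
  then show ?thesis using assms cell_size(1)[OF assms] by (simp add: field_simps)
qed

text \<open>A cell is at least \<open>B / 256\<close> words long. With ten blocks per row this gives
  the factor \<open>2560 * \<bar>c\<bar>\<close> for space, and with 82 I/Os per round the factor
  \<open>82 * 256 = 20992\<close> for time. The latter also absorbs the ten extra blocks due to
  rounding up.\<close>

lemma query_upper_bound:
  assumes mach: "em_machine M B w" "512 \<le> M" and U: "0 < U" "real U \<le> c * real n" "log 2 (real U) \<le> real w"
    and P: "P \<in> inputs U n"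
  defines "C \<equiv> 2560 * \<bar>c\<bar> + 20992"
  shows "\<exists>D. is_disk B w D \<and> real (length D) \<le> C * of_int \<lceil>real n / real B\<rceil> \<and>
    (\<forall>\<alpha>1<U. \<forall>\<alpha>2<U. \<forall>\<beta><U. \<exists>t.
      answers M B w (query_program M (cell_size B) w) U P D \<alpha>1 \<alpha>2 \<beta> D t \<and>
      real t \<le> C * (1 + real (card (range_skyline P (top_open U \<alpha>1 \<alpha>2 \<beta>))) / real B))"
proof -
  let ?b = "cell_size B"
  have B: "1 \<le> B" and M: "2 * B \<le> M" and w: "1 \<le> w" using mach by (auto simp: em_machine_def)
  have "real U \<le> 2 powr real w" using U by (simp add: log_le_iff)
  also have "\<dots> = real (2 ^ w)" by (simp add: powr_realpow)
  finally have Uw: "U \<le> 2 ^ w" by (simp only: of_nat_le_iff)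
  have n: "1 \<le> n" using U by (cases n) auto
  have Psub: "P \<subseteq> {..<U} \<times> {..<U}" and card: "card P = n" and inj: "inj_on fst P"
    using P by (auto simp: inputs_def general_position_def)
  have "P \<noteq> {}" using card n by auto
  then obtain x0 y0 where "(x0, y0) \<in> P" by auto
  then have x0: "0 < column P x0" using column_eq[OF inj] by simp
  define D where "D = map (\<lambda>a. cell ?b w x0 (column P) a @ replicate (B - ?b) 0) [0..<10 * ((U + ?b - 1) div ?b)]"
  interpret query_machine M B w ?b U P x0 D
    using cell_size[OF B] w cell_size_memory[OF M mach(2)] Uw Psub inj x0 D_def
    by unfold_locales auto
  let ?N = "of_int \<lceil>real n / real B\<rceil> :: real"
  have N1: "1 \<le> ?N" using n B by simp
  have N2: "real n / real B \<le> ?N" by (rule le_of_int_ceiling)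
  have "real ((U + ?b - 1) div ?b) \<le> real (U + ?b - 1) / real ?b" by (rule of_nat_div_le_of_nat)
  also have "\<dots> \<le> real (U + ?b) / real ?b" by (intro divide_right_mono) auto
  also have "\<dots> = real U / real ?b + 1" using cell_size(1)[OF B] by (simp add: field_simps)
  also have "real U / real ?b \<le> 256 * (real U / real B)" by (rule divide_cell_size[OF B])
  also have "real U / real B \<le> \<bar>c\<bar> * real n / real B"
    using U(2) by (intro divide_right_mono order_trans[OF U(2)] mult_right_mono) auto
  also have "\<dots> \<le> \<bar>c\<bar> * ?N" using mult_left_mono[OF N2, of "\<bar>c\<bar>"] by simp
  finally have rows: "real ((U + ?b - 1) div ?b) \<le> 256 * (\<bar>c\<bar> * ?N) + 1" by simp
  have "real (length D) \<le> 2560 * (\<bar>c\<bar> * ?N) + 10" using rows by (simp add: D_def)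
  also have "\<dots> \<le> 2560 * (\<bar>c\<bar> * ?N) + 20992 * ?N" using N1 by linarith
  also have "\<dots> = C * ?N" by (simp add: C_def algebra_simps)
  finally have space: "real (length D) \<le> C * ?N" .
  have "\<exists>t. answers M B w f U P D \<alpha>1 \<alpha>2 \<beta> D t \<and>
      real t \<le> C * (1 + real (card (range_skyline P (top_open U \<alpha>1 \<alpha>2 \<beta>))) / real B)"
    if \<alpha>: "\<alpha>1 < U" "\<alpha>2 < U" "\<beta> < U" for \<alpha>1 \<alpha>2 \<beta>
  proof -
    let ?k = "card (range_skyline P (top_open U \<alpha>1 \<alpha>2 \<beta>))"
    obtain t where ans: "answers M B w f U P D \<alpha>1 \<alpha>2 \<beta> D t" and t: "t \<le> 82 * (1 + ?k div ?b)"
      using answers_query[OF \<alpha>] by blast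
    have "real t \<le> real (82 * (1 + ?k div ?b))" using t by (rule of_nat_mono)
    also have "\<dots> = 82 * (1 + real (?k div ?b))" by (simp only: of_nat_mult of_nat_add) simp
    also have "real (?k div ?b) \<le> real ?k / real ?b" by (rule of_nat_div_le_of_nat)
    also have "\<dots> \<le> 256 * (real ?k / real B)" by (rule divide_cell_size[OF B])
    finally have "real t \<le> 82 * (1 + 256 * (real ?k / real B))" by (simp only: mult_left_mono add_left_mono)
    also have "\<dots> \<le> 20992 * (1 + real ?k / real B)" by (simp add: distrib_left)
    also have "\<dots> \<le> C * (1 + real ?k / real B)" by (intro mult_right_mono) (auto simp: C_def)
    finally show ?thesis using ans by blast
  qed
  then show ?thesis using is_disk space by blast
qed


section \<open>The lower bound\<close>

lemma run_output_length: "run M B w f m D D' out t \<Longrightarrow> length out \<le> t * B"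
  by (induction rule: run.induct) auto

lemma lists_points_length:
  assumes "lists_points out S" shows "length out = 2 * card S"
proof -
  from assms obtain ps where ps: "distinct ps" "set ps = S"
    and out: "out = concat (map (\<lambda>(x, y). [x, y]) ps)" by (auto simp: lists_points_def)
  have "length (concat (map (\<lambda>(x, y). [x, y]) ps)) = 2 * length ps" by (induction ps) auto
  then show ?thesis using ps out distinct_card by metis
qed

lemma answers_output_bound:
  assumes "answers M B w f U P D \<alpha>1 \<alpha>2 \<beta> D' t"
  shows "2 * card (range_skyline P (top_open U \<alpha>1 \<alpha>2 \<beta>)) \<le> t * B"
  using assms run_output_length lists_points_length unfolding answers_def by metis

text \<open>The first step depends on the query alone. A program that halts at once on one disk
  therefore halts at once on every disk and outputs nothing.\<close>

lemma answers_no_io: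
  assumes "answers M B w f U P D \<alpha>1 \<alpha>2 \<beta> D1 0" and "answers M B w f U P' D' \<alpha>1 \<alpha>2 \<beta> D2 t"
  shows "range_skyline P' (top_open U \<alpha>1 \<alpha>2 \<beta>) = {}"
proof -
  let ?m = "query_memory M \<alpha>1 \<alpha>2 \<beta>"
  obtain out1 where run1: "run M B w f ?m D D1 out1 0" using assms(1) by (auto simp: answers_def)
  obtain m' where halt: "f ?m = (m', Halt)" using run1 by (cases rule: run.cases) auto
  obtain out2 where run2: "run M B w f ?m D' D2 out2 t"
    and l: "lists_points out2 (range_skyline P' (top_open U \<alpha>1 \<alpha>2 \<beta>))"
    using assms(2) by (auto simp: answers_def)
  have "out2 = []" using run2 by (cases rule: run.cases) (use halt in auto)
  with l show ?thesis by (auto simp: lists_points_def)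
qed

lemma graph_in_inputs:
  assumes "inj_on g {..<n}" "g ` {..<n} \<subseteq> {..<U}" "n \<le> U"
  shows "(\<lambda>i. (i, g i)) ` {..<n} \<in> inputs U n"
  using assms unfolding inputs_def general_position_def
  by (auto simp: card_image inj_on_def)

lemma antichain_skyline:
  assumes "k \<le> n" "n \<le> U" "1 \<le> k"
  shows "range_skyline ((\<lambda>i. (i, n - 1 - i)) ` {..<n}) (top_open U 0 (k - 1) 0)
    = (\<lambda>i. (i, n - 1 - i)) ` {..<k}"
proof -
  have "(\<lambda>i. (i, n - 1 - i)) ` {..<n} \<inter> top_open U 0 (k - 1) 0 = (\<lambda>i. (i, n - 1 - i)) ` {..<k}"
    using assms by (auto simp: top_open_def)
  moreover have "skyline ((\<lambda>i. (i, n - 1 - i)) ` {..<k}) = (\<lambda>i. (i, n - 1 - i)) ` {..<k}"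
    using assms by (auto simp: skyline_def dominates_def)
  ultimately show ?thesis by (simp add: range_skyline_def)
qed

text \<open>The cost is at least 1 and at least \<open>k / B\<close>, hence at least half their sum.
  For positive \<open>k\<close> both follow from the output size on a descending antichain.\<close>

lemma query_lower_bound:
  assumes B: "em_machine M B w" and n: "1 \<le> n" "n \<le> U" and S: "skyline_structure M B w U n f \<D>"
    and k: "k \<le> n" "k = 0 \<Longrightarrow> 2 \<le> U"
  shows "\<exists>P\<in>inputs U n. \<exists>\<alpha>1 \<alpha>2 \<beta> D' t. \<alpha>1 \<le> \<alpha>2 \<and> \<alpha>2 < U \<and> \<beta> < U \<and>
    card (range_skyline P (top_open U \<alpha>1 \<alpha>2 \<beta>)) = k \<and>
    answers M B w f U P (\<D> P) \<alpha>1 \<alpha>2 \<beta> D' t \<and> 1 / 2 * (1 + real k / real B) \<le> real t"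
proof (cases "k = 0")
  case True
  then have U: "2 \<le> U" using k by simp
  \<comment> \<open>Exchanging the heights of columns 0 and 1 in the diagonal puts a point into the
    query with column 0 and \<beta> = 1, which is empty on the diagonal itself. This needs two
    heights, that is \<open>2 \<le> U\<close>.\<close>
  define g where "g i = (if i = 0 then 1 else if i = 1 then 0 else i)" for i :: nat
  define P where "P = (\<lambda>i. (i, i)) ` {..<n}"
  define P' where "P' = (\<lambda>i. (i, g i)) ` {..<n}"
  have in_P: "P \<in> inputs U n" unfolding P_def using n by (intro graph_in_inputs) auto
  have in_P': "P' \<in> inputs U n" unfolding P'_def using n U
    by (intro graph_in_inputs) (auto simp: g_def inj_on_def split: if_splits)
  have empty: "range_skyline P (top_open U 0 0 1) = {}"
    by (auto simp: P_def range_skyline_def top_open_def skyline_def)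
  have "P' \<inter> top_open U 0 0 1 = {(0, 1)}"
    using n U by (auto simp: P'_def top_open_def g_def)
  then have nonempty: "range_skyline P' (top_open U 0 0 1) \<noteq> {}"
    by (simp add: range_skyline_def skyline_def dominates_def)
  obtain D' t where ans: "answers M B w f U P (\<D> P) 0 0 1 D' t"
    using S in_P U unfolding skyline_structure_def by fastforce
  obtain D'' t' where ans': "answers M B w f U P' (\<D> P') 0 0 1 D'' t'"
    using S in_P' U unfolding skyline_structure_def by fastforce
  have "t \<noteq> 0"
  proof
    assume "t = 0"
    with answers_no_io[OF _ ans'] ans nonempty show False by simp
  qed
  then have "1 / 2 * (1 + real k / real B) \<le> real t" using True by simp
  then show ?thesis using in_P ans empty True U
    by (intro bexI[OF _ in_P] exI[of _ 0] exI[of _ 1] exI[of _ D'] exI[of _ t]) auto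
next
  case False
  define P where "P = (\<lambda>i. (i, n - 1 - i)) ` {..<n}"
  have in_P: "P \<in> inputs U n" unfolding P_def using n by (intro graph_in_inputs) (auto simp: inj_on_def)
  have "range_skyline P (top_open U 0 (k - 1) 0) = (\<lambda>i. (i, n - 1 - i)) ` {..<k}"
    unfolding P_def using k n False by (intro antichain_skyline) auto
  then have card: "card (range_skyline P (top_open U 0 (k - 1) 0)) = k"
    by (simp add: card_image inj_on_def)
  obtain D' t where ans: "answers M B w f U P (\<D> P) 0 (k - 1) 0 D' t"
    using S in_P k n False unfolding skyline_structure_def by (metis One_nat_def Suc_leI bot_nat_0.not_eq_extremum diff_less le_trans less_le_trans zero_less_one)
  have tB: "2 * k \<le> t * B" using answers_output_bound[OF ans] card by simp
  have "1 \<le> B" using B by (simp add: em_machine_def)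
  have "t \<noteq> 0" using tB False by (metis mult_0 mult_is_0 le_zero_eq numeral_2_eq_2 old.nat.distinct(2))
  then have "1 \<le> real t" by simp
  moreover have "real k / real B \<le> real t"
  proof -
    have "real k \<le> real t * real B" using tB by (metis mult_2 le_add1 le_trans of_nat_le_iff of_nat_mult)
    then show ?thesis using \<open>1 \<le> B\<close> by (simp add: divide_le_eq)
  qed
  ultimately have "1 / 2 * (1 + real k / real B) \<le> real t" by simp
  then show ?thesis using ans card k n False
    by (intro bexI[OF _ in_P] exI[of _ 0] exI[of _ "k - 1"] exI[of _ D'] exI[of _ t]) auto
qed


section \<open>The two bounds combined\<close>

theorem theorem2:
  shows
    "(\<forall>c::real. \<exists>(C::real) (m0::nat). \<forall>M B w.
        em_machine M B w \<and> m0 \<le> M \<longrightarrow>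
        (\<exists>f::program. \<forall>U n P.
           0 < U \<and> real U \<le> c * real n \<and> log 2 (real U) \<le> real w \<and> P \<in> inputs U n \<longrightarrow>
           (\<exists>D. is_disk B w D \<and>
                real (length D) \<le> C * of_int \<lceil>real n / real B\<rceil> \<and>
                (\<forall>\<alpha>1<U. \<forall>\<alpha>2<U. \<forall>\<beta><U. \<exists>t.
                   answers M B w f U P D \<alpha>1 \<alpha>2 \<beta> D t \<and>
                   real t \<le> C * (1 + real (card (range_skyline P (top_open U \<alpha>1 \<alpha>2 \<beta>))) / real B)))))
     \<and>
     (\<exists>c>0::real. \<forall>M B w U n f \<D>.
        em_machine M B w \<and> 1 \<le> n \<and> n \<le> U \<and> log 2 (real U) \<le> real w \<and>
        skyline_structure M B w U n f \<D> \<longrightarrow>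
        (\<forall>k\<le>n. (k = 0 \<longrightarrow> 2 \<le> U) \<longrightarrow>
           (\<exists>P\<in>inputs U n. \<exists>\<alpha>1 \<alpha>2 \<beta> D' t.
              \<alpha>1 \<le> \<alpha>2 \<and> \<alpha>2 < U \<and> \<beta> < U \<and>
              card (range_skyline P (top_open U \<alpha>1 \<alpha>2 \<beta>)) = k \<and>
              answers M B w f U P (\<D> P) \<alpha>1 \<alpha>2 \<beta> D' t \<and>
              c * (1 + real k / real B) \<le> real t)))"
proof (intro conjI allI)
  fix c :: real
  show "\<exists>(C::real) (m0::nat). \<forall>M B w.
        em_machine M B w \<and> m0 \<le> M \<longrightarrow>
        (\<exists>f::program. \<forall>U n P.
           0 < U \<and> real U \<le> c * real n \<and> log 2 (real U) \<le> real w \<and> P \<in> inputs U n \<longrightarrow>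
           (\<exists>D. is_disk B w D \<and>
                real (length D) \<le> C * of_int \<lceil>real n / real B\<rceil> \<and>
                (\<forall>\<alpha>1<U. \<forall>\<alpha>2<U. \<forall>\<beta><U. \<exists>t.
                   answers M B w f U P D \<alpha>1 \<alpha>2 \<beta> D t \<and>
                   real t \<le> C * (1 + real (card (range_skyline P (top_open U \<alpha>1 \<alpha>2 \<beta>))) / real B))))"
  \<comment> \<open>The query program is determined by \<open>M\<close>, \<open>B\<close> and
    \<open>w\<close>, so it can be fixed before \<open>U\<close>, \<open>n\<close> and
    \<open>P\<close>.\<close>
  proof (rule exI, rule exI, intro allI impI, rule exI, intro allI impI)
    fix M B w U n P
    assume "em_machine M B w \<and> 512 \<le> M"
      and "0 < U \<and> real U \<le> c * real n \<and> log 2 (real U) \<le> real w \<and> P \<in> inputs U n"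
    then show "\<exists>D. is_disk B w D \<and>
        real (length D) \<le> (2560 * \<bar>c\<bar> + 20992) * of_int \<lceil>real n / real B\<rceil> \<and>
        (\<forall>\<alpha>1<U. \<forall>\<alpha>2<U. \<forall>\<beta><U. \<exists>t.
           answers M B w (query_program M (cell_size B) w) U P D \<alpha>1 \<alpha>2 \<beta> D t \<and>
           real t \<le> (2560 * \<bar>c\<bar> + 20992) *
             (1 + real (card (range_skyline P (top_open U \<alpha>1 \<alpha>2 \<beta>))) / real B))"
      using query_upper_bound by blast
  qed
next
  show "\<exists>c>0::real. \<forall>M B w U n f \<D>.
        em_machine M B w \<and> 1 \<le> n \<and> n \<le> U \<and> log 2 (real U) \<le> real w \<and>
        skyline_structure M B w U n f \<D> \<longrightarrow>
        (\<forall>k\<le>n. (k = 0 \<longrightarrow> 2 \<le> U) \<longrightarrow>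
           (\<exists>P\<in>inputs U n. \<exists>\<alpha>1 \<alpha>2 \<beta> D' t.
              \<alpha>1 \<le> \<alpha>2 \<and> \<alpha>2 < U \<and> \<beta> < U \<and>
              card (range_skyline P (top_open U \<alpha>1 \<alpha>2 \<beta>)) = k \<and>
              answers M B w f U P (\<D> P) \<alpha>1 \<alpha>2 \<beta> D' t \<and>
              c * (1 + real k / real B) \<le> real t))"
  proof (intro exI[of _ "1 / 2"] conjI allI impI)
    fix M B w U n f \<D> and k :: nat
    assume "em_machine M B w \<and> 1 \<le> n \<and> n \<le> U \<and> log 2 (real U) \<le> real w \<and>
        skyline_structure M B w U n f \<D>"
      and "k \<le> n" "k = 0 \<longrightarrow> 2 \<le> U"
    then show "\<exists>P\<in>inputs U n. \<exists>\<alpha>1 \<alpha>2 \<beta> D' t.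
        \<alpha>1 \<le> \<alpha>2 \<and> \<alpha>2 < U \<and> \<beta> < U \<and>
        card (range_skyline P (top_open U \<alpha>1 \<alpha>2 \<beta>)) = k \<and>
        answers M B w f U P (\<D> P) \<alpha>1 \<alpha>2 \<beta> D' t \<and>
        1 / 2 * (1 + real k / real B) \<le> real t"
      by (elim conjE) (rule query_lower_bound; blast)
  qed simp
qed

end
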